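(* Let $(X,T)$ be a topological dynamical system and $\varphi\in C(X,\mathbb{R})$. Then $$P_{\mathrm{top}}(T,\varphi)=\lim_{\varepsilon\to0}\liminf_{n\to\infty}\frac1n\log S_n^{FK}(\varphi,\varepsilon)=\lim_{\varepsilon\to0}\limsup_{n\to\infty}\frac1n\log S_n^{FK}(\varphi,\varepsilon).$$
   Context: A topological dynamical system is a pair $(X,T)$ where $X$ is a compact metric space with metric $d$ and $T:X\to X$ is a homeomorphism. $C(X,\mathbb{R})$ is the set of continuous real-valued functions on $X$. $[n]=\{0,1,\dots,n-1\}$. For integers $n,q\ge1$ put $S_n^q\varphi(x)=\sum_{i=0}^{n-1}\varphi(T^{qi}x)$ and $S_n\varphi=S_n^1\varphi$. Let $d_n(x,y)=\max_{0\le i\le n-1}d(T^ix,T^iy)$; an $(n,\varepsilon)$-spanning set for $X$ is a spanning set in the usual Bowen sense with respect to $d_n$. The topological pressure is $$P_{\mathrm{top}}(T,\varphi)=\lim_{\varepsilon\to0}\limsup_{n\to\infty}\frac1n\log P_n(T,\varphi,\varepsilon),\qquad P_n(T,\varphi,\varepsilon)=\inf\Big\{\sum_{x\in F}e^{S_n\varphi(x)}:F\text{ is an }(n,\varepsilon)\text{-spanning set for }X\Big\}.$$ For $x,y\in X$, $\delta>0$ and integers $n,q\ge1$, a $(q,n,\delta)$-match of $x$ and $y$ is an order-preserving bijection $\pi:D(\pi)\to R(\pi)$ (i.e. $\pi(i)<\pi(j)$ whenever $i<j$) with $D(\pi),R(\pi)\subset[n]$ and $d(T^{qi}x,T^{q\pi(i)}y)<\delta$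 for every $i\in D(\pi)$; $|\pi|$ denotes the cardinality of $D(\pi)$. Put $$\mathscr{F}^q_{n,\delta}(x,y)=1-\frac{\max\{|\pi|:\pi\text{ is a }(q,n,\delta)\text{-match of }x\text{ and }y\}}{n},\qquad d_{FK_n^q}(x,y)=\inf\{\delta>0:\mathscr{F}^q_{n,\delta}(x,y)<\delta\},$$ and $B_{d_{FK_n^q}}(x,\varepsilon)=\{y\in X:d_{FK_n^q}(x,y)<\varepsilon\}$. For $\varepsilon>0$, $$S_{d_{FK_n^q}}(\varphi,\varepsilon)=\inf\Big\{\sum_{i=1}^k e^{S_n^q\varphi(x_i)}:\ \bigcup_{i=1}^kB_{d_{FK_n^q}}(x_i,\varepsilon)=X\Big\},$$ the infimum being over finite collections $x_1,\dots,x_k\in X$, and $$S_n^{FK}(\varphi,\varepsilon)=\inf_{q\ge1}S_{d_{FK_n^q}}(\varphi,\varepsilon).$$ *)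

theory Defs
  imports "HOL-Analysis.Analysis"
begin

text \<open>
  The phase space is a compact subset X of an ambient metric space and T is only relevant on X.
  For nonempty X all quantities to which ln is applied below are positive; the value at
  n = 0 never matters, as only the limit in n is used.
\<close>

definition birkhoff_sum :: "('a \<Rightarrow> 'a) \<Rightarrow> nat \<Rightarrow> nat \<Rightarrow> ('a \<Rightarrow> real) \<Rightarrow> 'a \<Rightarrow> real" where
  "birkhoff_sum T q n \<phi> x = (\<Sum>i<n. \<phi> ((T ^^ (q * i)) x))"

definition bowen_dist :: "('a::metric_space \<Rightarrow> 'a) \<Rightarrow> nat \<Rightarrow> 'a \<Rightarrow> 'a \<Rightarrow> real" where
  "bowen_dist T n x y = (MAX i\<in>{..<n}. dist ((T ^^ i) x) ((T ^^ i) y))"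

text \<open>
  Finiteness of spanning sets is part of the definition: \<open>sum\<close> over an infinite
  set would be 0 rather than infinite.  As in Bowen's definition, the inequality is not strict.
\<close>

definition spanning_set ::
    "'a::metric_space set \<Rightarrow> ('a \<Rightarrow> 'a) \<Rightarrow> nat \<Rightarrow> real \<Rightarrow> 'a set \<Rightarrow> bool" where
  "spanning_set X T n \<epsilon> F \<longleftrightarrow>
     finite F \<and> F \<subseteq> X \<and> (\<forall>x\<in>X. \<exists>y\<in>F. bowen_dist T n x y \<le> \<epsilon>)"

definition spanning_pressure ::
    "'a::metric_space set \<Rightarrow> ('a \<Rightarrow> 'a) \<Rightarrow> ('a \<Rightarrow> real) \<Rightarrow> nat \<Rightarrow> real \<Rightarrow> real" where
  "spanning_pressure X T \<phi> n \<epsilon> =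
     Inf {\<Sum>x\<in>F. exp (birkhoff_sum T 1 n \<phi> x) | F. spanning_set X T n \<epsilon> F}"

text \<open>The limit exists because the limit superior is antitone in \<open>\<epsilon>\<close>; it may be infinite.\<close>

definition top_pressure ::
    "'a::metric_space set \<Rightarrow> ('a \<Rightarrow> 'a) \<Rightarrow> ('a \<Rightarrow> real) \<Rightarrow> ereal" where
  "top_pressure X T \<phi> =
     Lim (at_right 0)
       (\<lambda>\<epsilon>. limsup (\<lambda>n. ereal (1 / real n * ln (spanning_pressure X T \<phi> n \<epsilon>))))"

definition fk_match ::
    "('a::metric_space \<Rightarrow> 'a) \<Rightarrow> nat \<Rightarrow> nat \<Rightarrow> real \<Rightarrow> 'a \<Rightarrow> 'a
      \<Rightarrow> nat set \<Rightarrow> nat set \<Rightarrow> (nat \<Rightarrow> nat) \<Rightarrow> bool" where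
  "fk_match T q n \<delta> x y D R \<pi> \<longleftrightarrow>
     D \<subseteq> {..<n} \<and> R \<subseteq> {..<n} \<and> bij_betw \<pi> D R \<and> strict_mono_on D \<pi> \<and>
     (\<forall>i\<in>D. dist ((T ^^ (q * i)) x) ((T ^^ (q * \<pi> i)) y) < \<delta>)"

definition fk_defect ::
    "('a::metric_space \<Rightarrow> 'a) \<Rightarrow> nat \<Rightarrow> nat \<Rightarrow> real \<Rightarrow> 'a \<Rightarrow> 'a \<Rightarrow> real" where
  "fk_defect T q n \<delta> x y =
     1 - real (Max {card D | D R \<pi>. fk_match T q n \<delta> x y D R \<pi>}) / real n"

definition fk_dist ::
    "('a::metric_space \<Rightarrow> 'a) \<Rightarrow> nat \<Rightarrow> nat \<Rightarrow> 'a \<Rightarrow> 'a \<Rightarrow> real" where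
  "fk_dist T q n x y = Inf {\<delta>. \<delta> > 0 \<and> fk_defect T q n \<delta> x y < \<delta>}"

definition fk_ball ::
    "'a::metric_space set \<Rightarrow> ('a \<Rightarrow> 'a) \<Rightarrow> nat \<Rightarrow> nat \<Rightarrow> 'a \<Rightarrow> real \<Rightarrow> 'a set" where
  "fk_ball X T q n x \<epsilon> = {y \<in> X. fk_dist T q n x y < \<epsilon>}"

definition fk_cover_sum ::
    "'a::metric_space set \<Rightarrow> ('a \<Rightarrow> 'a) \<Rightarrow> ('a \<Rightarrow> real) \<Rightarrow> nat \<Rightarrow> nat \<Rightarrow> real \<Rightarrow> real" where
  "fk_cover_sum X T \<phi> q n \<epsilon> =
     Inf {\<Sum>i=1..k. exp (birkhoff_sum T q n \<phi> (x i)) | (k::nat) x.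
            (\<forall>i\<in>{1..k}. x i \<in> X) \<and> (\<Union>i\<in>{1..k}. fk_ball X T q n (x i) \<epsilon>) = X}"

definition fk_sum ::
    "'a::metric_space set \<Rightarrow> ('a \<Rightarrow> 'a) \<Rightarrow> ('a \<Rightarrow> real) \<Rightarrow> nat \<Rightarrow> real \<Rightarrow> real" where
  "fk_sum X T \<phi> n \<epsilon> = (INF q\<in>{1..}. fk_cover_sum X T \<phi> q n \<epsilon>)"

end

theory Submission imports Defs "HOL-Real_Asymp.Real_Asymp"
begin

text \<open>
  The pressure is compared with the FK sums without invariant measures. A family of weighted
  sets that cover X, each of which has small diameter at the times in A and a weight dominating
  the exponential of the Birkhoff sum over A, can be intersected with such a family for a disjoint
  set of times (the weights multiply) and translated in time (the weights stay). Hence a family of total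
  weight W for the times 0, q, ..., (n-1)q yields one of total weight about \<open>W^(m/n)\<close> for the
  times 0, ..., m-1, and the pressure at that scale is at most \<open>ln W / n\<close>, for every n and q.

  Such families come from FK balls: once the domain and range of a match are fixed, the
  orbit of a point of the ball follows the orbit of the centre at the matched times, and at
  the at most \<open>\<epsilon> n\<close> other times X is cut into a number of small pieces which depends
  only on the fixed scale \<open>\<rho>\<close>. As \<open>\<epsilon>\<close> tends to 0 with \<open>\<rho>\<close> fixed, the number of
  choices has exponential growth rate tending to 0. Conversely, the FK distance with q = 1 is
  controlled by the Bowen distance.
\<close>

section \<open>Weighted covers along sets of times\<close>

lemma funpow_mem:
  assumes "T ` X \<subseteq> X" "x \<in> X"
  shows "(T ^^ a) x \<in> X"
  using assms by (induction a) auto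

text \<open>
  The pieces are pairs of a set and its weight, rather than sets weighted by the supremum of the
  Birkhoff sum, so that intersections and preimages need no nonemptiness assumptions.
\<close>

definition orbit_cover ::
    "('a::metric_space \<Rightarrow> 'a) \<Rightarrow> ('a \<Rightarrow> real) \<Rightarrow> real \<Rightarrow> 'a set \<Rightarrow> nat set \<Rightarrow> real \<Rightarrow> bool" where
  "orbit_cover T \<phi> \<rho> Y A W \<longleftrightarrow>
     (\<exists>\<U>. finite \<U> \<and> Y \<subseteq> \<Union> (fst ` \<U>) \<and> sum snd \<U> \<le> W \<and>
        (\<forall>p\<in>\<U>. 0 \<le> snd p \<and>
           (\<forall>x\<in>fst p. exp (\<Sum>a\<in>A. \<phi> ((T ^^ a) x)) \<le> snd p) \<and>
           (\<forall>x\<in>fst p. \<forall>y\<in>fst p. \<forall>a\<in>A. dist ((T ^^ a) x) ((T ^^ a) y) \<le> \<rho>)))"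

lemma orbit_coverI:
  assumes "finite \<U>" "Y \<subseteq> \<Union> (fst ` \<U>)" "sum snd \<U> \<le> W"
    and "\<And>p. p \<in> \<U> \<Longrightarrow> 0 \<le> snd p"
    and "\<And>p x. p \<in> \<U> \<Longrightarrow> x \<in> fst p \<Longrightarrow> exp (\<Sum>a\<in>A. \<phi> ((T ^^ a) x)) \<le> snd p"
    and "\<And>p x y a. p \<in> \<U> \<Longrightarrow> x \<in> fst p \<Longrightarrow> y \<in> fst p \<Longrightarrow> a \<in> A \<Longrightarrow>
           dist ((T ^^ a) x) ((T ^^ a) y) \<le> \<rho>"
  shows "orbit_cover T \<phi> \<rho> Y A W"
  unfolding orbit_cover_def using assms by (intro exI[of _ \<U>]) blast

lemma orbit_coverE:
  assumes "orbit_cover T \<phi> \<rho> Y A W"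
  obtains \<U> where "finite \<U>" "Y \<subseteq> \<Union> (fst ` \<U>)" "sum snd \<U> \<le> W"
    and "\<And>p. p \<in> \<U> \<Longrightarrow> 0 \<le> snd p"
    and "\<And>p x. p \<in> \<U> \<Longrightarrow> x \<in> fst p \<Longrightarrow> exp (\<Sum>a\<in>A. \<phi> ((T ^^ a) x)) \<le> snd p"
    and "\<And>p x y a. p \<in> \<U> \<Longrightarrow> x \<in> fst p \<Longrightarrow> y \<in> fst p \<Longrightarrow> a \<in> A \<Longrightarrow>
           dist ((T ^^ a) x) ((T ^^ a) y) \<le> \<rho>"
  using assms unfolding orbit_cover_def by blast

lemma orbit_cover_mono:
  assumes "orbit_cover T \<phi> \<rho> Y A W" "Y' \<subseteq> Y" "W \<le> W'"
  shows "orbit_cover T \<phi> \<rho> Y' A W'"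
  using assms(1)
proof (rule orbit_coverE)
  fix \<U> assume "finite \<U>" "Y \<subseteq> \<Union> (fst ` \<U>)" "sum snd \<U> \<le> W"
    and "\<And>p. p \<in> \<U> \<Longrightarrow> 0 \<le> snd p"
    and "\<And>p x. p \<in> \<U> \<Longrightarrow> x \<in> fst p \<Longrightarrow> exp (\<Sum>a\<in>A. \<phi> ((T ^^ a) x)) \<le> snd p"
    and "\<And>p x y a. p \<in> \<U> \<Longrightarrow> x \<in> fst p \<Longrightarrow> y \<in> fst p \<Longrightarrow> a \<in> A \<Longrightarrow>
           dist ((T ^^ a) x) ((T ^^ a) y) \<le> \<rho>"
  then show ?thesis
    using assms(2,3) by (intro orbit_coverI[of \<U>]) auto
qed

lemma orbit_cover_no_times: "orbit_cover T \<phi> \<rho> Y {} 1"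
  by (rule orbit_coverI[of "{(Y, 1)}"]) auto

lemma orbit_cover_no_points: "0 \<le> W \<Longrightarrow> orbit_cover T \<phi> \<rho> {} A W"
  by (rule orbit_coverI[of "{}"]) auto

text \<open>One piece suffices: two points within \<open>\<rho> / 2\<close> of a common
  \<open>z\<close> are within \<open>\<rho>\<close> of each other. As \<open>z\<close> is arbitrary,
  it can be a net point or a point on the orbit of the centre of an FK ball.\<close>

lemma orbit_cover_singleton:
  assumes "\<And>y. y \<in> Y \<Longrightarrow> dist ((T ^^ a) y) z \<le> \<rho> / 2"
    and "\<And>y. y \<in> Y \<Longrightarrow> \<phi> ((T ^^ a) y) \<le> c"
  shows "orbit_cover T \<phi> \<rho> Y {a} (exp c)"
proof (rule orbit_coverI[of "{(Y, exp c)}"])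
  fix p x y b assume "p \<in> {(Y, exp c)}" "x \<in> fst p" "y \<in> fst p" "b \<in> {a}"
  then have "dist ((T ^^ b) x) z \<le> \<rho> / 2" "dist ((T ^^ b) y) z \<le> \<rho> / 2"
    using assms(1) by auto
  then show "dist ((T ^^ b) x) ((T ^^ b) y) \<le> \<rho>"
    using dist_triangle2[of "(T ^^ b) x" "(T ^^ b) y" z] by linarith
qed (use assms(2) in auto)

text \<open>Common refinement: intersecting the pieces keeps both diameter bounds. Since the sets of
  times are disjoint, the Birkhoff sums add, so the weights multiply and the total is at most the
  product of the totals.\<close>

lemma orbit_cover_Un_times:
  assumes V: "orbit_cover T \<phi> \<rho> Y A V" and W: "orbit_cover T \<phi> \<rho> Y B W"
    and AB: "finite A" "finite B" "A \<inter> B = {}"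
  shows "orbit_cover T \<phi> \<rho> Y (A \<union> B) (V * W)"
proof -
  obtain \<V> where \<V>: "finite \<V>" "Y \<subseteq> \<Union> (fst ` \<V>)" "sum snd \<V> \<le> V"
    "\<And>p. p \<in> \<V> \<Longrightarrow> 0 \<le> snd p"
    "\<And>p x. p \<in> \<V> \<Longrightarrow> x \<in> fst p \<Longrightarrow> exp (\<Sum>a\<in>A. \<phi> ((T ^^ a) x)) \<le> snd p"
    "\<And>p x y a. p \<in> \<V> \<Longrightarrow> x \<in> fst p \<Longrightarrow> y \<in> fst p \<Longrightarrow> a \<in> A \<Longrightarrow>
           dist ((T ^^ a) x) ((T ^^ a) y) \<le> \<rho>"
    using V by (rule orbit_coverE) blast
  obtain \<W> where \<W>: "finite \<W>" "Y \<subseteq> \<Union> (fst ` \<W>)" "sum snd \<W> \<le> W"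
    "\<And>p. p \<in> \<W> \<Longrightarrow> 0 \<le> snd p"
    "\<And>p x. p \<in> \<W> \<Longrightarrow> x \<in> fst p \<Longrightarrow> exp (\<Sum>a\<in>B. \<phi> ((T ^^ a) x)) \<le> snd p"
    "\<And>p x y a. p \<in> \<W> \<Longrightarrow> x \<in> fst p \<Longrightarrow> y \<in> fst p \<Longrightarrow> a \<in> B \<Longrightarrow>
           dist ((T ^^ a) x) ((T ^^ a) y) \<le> \<rho>"
    using W by (rule orbit_coverE) blast
  define f :: "('a set \<times> real) \<times> ('a set \<times> real) \<Rightarrow> 'a set \<times> real"
    where "f = (\<lambda>(p, p'). (fst p \<inter> fst p', snd p * snd p'))"
  show ?thesis
  proof (rule orbit_coverI[of "f ` (\<V> \<times> \<W>)"])
    show "finite (f ` (\<V> \<times> \<W>))"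
      using \<V>(1) \<W>(1) by simp
    show "Y \<subseteq> \<Union> (fst ` f ` (\<V> \<times> \<W>))"
    proof
      fix y assume "y \<in> Y"
      then obtain p p' where "p \<in> \<V>" "y \<in> fst p" "p' \<in> \<W>" "y \<in> fst p'"
        using \<V>(2) \<W>(2) by blast
      then have "f (p, p') \<in> f ` (\<V> \<times> \<W>)" "y \<in> fst (f (p, p'))"
        by (auto simp: f_def)
      then show "y \<in> \<Union> (fst ` f ` (\<V> \<times> \<W>))" by blast
    qed
    \<comment> \<open>Different pairs may yield the same piece with the same weight, which the image
      counts once; nonnegative weights make this an inequality in the right direction.\<close>
    have "sum snd (f ` (\<V> \<times> \<W>)) \<le> sum (snd \<circ> f) (\<V> \<times> \<W>)"
      using \<V>(1,4) \<W>(1,4) by (intro sum_image_le) (auto simp: f_def)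
    also have "\<dots> = sum snd \<V> * sum snd \<W>"
      by (simp add: f_def sum_product sum.cartesian_product case_prod_unfold)
    also have "\<dots> \<le> V * W"
      using \<V>(3,4) \<W>(3,4) sum_nonneg[of \<V> snd] sum_nonneg[of \<W> snd]
      by (intro mult_mono) auto
    finally show "sum snd (f ` (\<V> \<times> \<W>)) \<le> V * W" .
    show "0 \<le> snd p" if "p \<in> f ` (\<V> \<times> \<W>)" for p
      using that \<V>(4) \<W>(4) by (auto simp: f_def)
    show "exp (\<Sum>a\<in>A \<union> B. \<phi> ((T ^^ a) x)) \<le> snd p"
      if p: "p \<in> f ` (\<V> \<times> \<W>)" and x: "x \<in> fst p" for p x
    proof -
      obtain u v where uv: "u \<in> \<V>" "v \<in> \<W>" "p = f (u, v)" using p by auto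
      then have "x \<in> fst u" "x \<in> fst v" using x by (auto simp: f_def)
      then have "exp (\<Sum>a\<in>A. \<phi> ((T ^^ a) x)) * exp (\<Sum>a\<in>B. \<phi> ((T ^^ a) x)) \<le> snd u * snd v"
        using uv \<V>(4,5) \<W>(4,5) by (intro mult_mono) auto
      then show ?thesis
        using uv AB by (simp add: f_def sum.union_disjoint exp_add)
    qed
    show "dist ((T ^^ a) x) ((T ^^ a) y) \<le> \<rho>"
      if "p \<in> f ` (\<V> \<times> \<W>)" "x \<in> fst p" "y \<in> fst p" "a \<in> A \<union> B" for p x y a
      using that \<V>(6) \<W>(6) by (auto simp: f_def)
  qed
qed

lemma orbit_cover_prod:
  assumes "finite J" "inj_on t J" "\<And>j. j \<in> J \<Longrightarrow> orbit_cover T \<phi> \<rho> Y {t j} (w j)"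
  shows "orbit_cover T \<phi> \<rho> Y (t ` J) (\<Prod>j\<in>J. w j)"
  using assms
proof (induction J rule: finite_induct)
  case empty
  then show ?case by (simp add: orbit_cover_no_times)
next
  case (insert j J)
  have "orbit_cover T \<phi> \<rho> Y ({t j} \<union> t ` J) (w j * (\<Prod>j\<in>J. w j))"
    using insert by (intro orbit_cover_Un_times) auto
  then show ?case using insert by simp
qed

lemma orbit_cover_Un_points:
  assumes V: "orbit_cover T \<phi> \<rho> Y A V" and W: "orbit_cover T \<phi> \<rho> Z A W"
  shows "orbit_cover T \<phi> \<rho> (Y \<union> Z) A (V + W)"
proof -
  obtain \<V> where \<V>: "finite \<V>" "Y \<subseteq> \<Union> (fst ` \<V>)" "sum snd \<V> \<le> V"
    "\<And>p. p \<in> \<V> \<Longrightarrow> 0 \<le> snd p"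
    "\<And>p x. p \<in> \<V> \<Longrightarrow> x \<in> fst p \<Longrightarrow> exp (\<Sum>a\<in>A. \<phi> ((T ^^ a) x)) \<le> snd p"
    "\<And>p x y a. p \<in> \<V> \<Longrightarrow> x \<in> fst p \<Longrightarrow> y \<in> fst p \<Longrightarrow> a \<in> A \<Longrightarrow>
           dist ((T ^^ a) x) ((T ^^ a) y) \<le> \<rho>"
    using V by (rule orbit_coverE) blast
  obtain \<W> where \<W>: "finite \<W>" "Z \<subseteq> \<Union> (fst ` \<W>)" "sum snd \<W> \<le> W"
    "\<And>p. p \<in> \<W> \<Longrightarrow> 0 \<le> snd p"
    "\<And>p x. p \<in> \<W> \<Longrightarrow> x \<in> fst p \<Longrightarrow> exp (\<Sum>a\<in>A. \<phi> ((T ^^ a) x)) \<le> snd p"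
    "\<And>p x y a. p \<in> \<W> \<Longrightarrow> x \<in> fst p \<Longrightarrow> y \<in> fst p \<Longrightarrow> a \<in> A \<Longrightarrow>
           dist ((T ^^ a) x) ((T ^^ a) y) \<le> \<rho>"
    using W by (rule orbit_coverE) blast
  show ?thesis
  proof (rule orbit_coverI[of "\<V> \<union> \<W>"])
    have "sum snd (\<V> \<union> \<W>) + sum snd (\<V> \<inter> \<W>) = sum snd \<V> + sum snd \<W>"
      using \<V>(1) \<W>(1) by (rule sum.union_inter)
    moreover have "0 \<le> sum snd (\<V> \<inter> \<W>)"
      using \<V>(4) by (intro sum_nonneg) auto
    ultimately show "sum snd (\<V> \<union> \<W>) \<le> V + W"
      using \<V>(3) \<W>(3) by linarith
    show "finite (\<V> \<union> \<W>)" using \<V>(1) \<W>(1) by simp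
    show "Y \<union> Z \<subseteq> \<Union> (fst ` (\<V> \<union> \<W>))" using \<V>(2) \<W>(2) by blast
  qed (use \<V>(4-6) \<W>(4-6) in auto)
qed

lemma orbit_cover_UN:
  assumes "finite I" "\<And>i. i \<in> I \<Longrightarrow> orbit_cover T \<phi> \<rho> (Y i) A (W i)"
  shows "orbit_cover T \<phi> \<rho> (\<Union>i\<in>I. Y i) A (\<Sum>i\<in>I. W i)"
  using assms
proof (induction I rule: finite_induct)
  case empty
  then show ?case by (simp add: orbit_cover_no_points)
next
  case (insert i I)
  have "orbit_cover T \<phi> \<rho> (Y i \<union> (\<Union>i\<in>I. Y i)) A (W i + (\<Sum>i\<in>I. W i))"
    using insert by (intro orbit_cover_Un_points) auto
  then show ?case using insert by simp
qed

text \<open>Pull the pieces back under \<open>T ^^ t\<close>: the Birkhoff sum of \<open>x\<close>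
  over the shifted times is that of \<open>(T ^^ t) x\<close> over \<open>A\<close>, so no weight
  changes.\<close>

lemma orbit_cover_shift:
  assumes W: "orbit_cover T \<phi> \<rho> Z A W" and YZ: "(T ^^ t) ` Y \<subseteq> Z"
  shows "orbit_cover T \<phi> \<rho> Y ((+) t ` A) W"
proof -
  obtain \<W> where \<W>: "finite \<W>" "Z \<subseteq> \<Union> (fst ` \<W>)" "sum snd \<W> \<le> W"
    "\<And>p. p \<in> \<W> \<Longrightarrow> 0 \<le> snd p"
    "\<And>p x. p \<in> \<W> \<Longrightarrow> x \<in> fst p \<Longrightarrow> exp (\<Sum>a\<in>A. \<phi> ((T ^^ a) x)) \<le> snd p"
    "\<And>p x y a. p \<in> \<W> \<Longrightarrow> x \<in> fst p \<Longrightarrow> y \<in> fst p \<Longrightarrow> a \<in> A \<Longrightarrow>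
           dist ((T ^^ a) x) ((T ^^ a) y) \<le> \<rho>"
    using W by (rule orbit_coverE) blast
  have T_add: "(T ^^ (t + a)) x = (T ^^ a) ((T ^^ t) x)" for a x
    by (subst add.commute) (simp add: funpow_add)
  define f :: "'a set \<times> real \<Rightarrow> 'a set \<times> real" where "f = (\<lambda>p. ((T ^^ t) -` fst p, snd p))"
  show ?thesis
  proof (rule orbit_coverI[of "f ` \<W>"])
    show "finite (f ` \<W>)" using \<W>(1) by simp
    show "Y \<subseteq> \<Union> (fst ` f ` \<W>)"
    proof
      fix y assume "y \<in> Y"
      then obtain p where "p \<in> \<W>" "(T ^^ t) y \<in> fst p" using YZ \<W>(2) by blast
      then show "y \<in> \<Union> (fst ` f ` \<W>)" by (auto simp: f_def)
    qed
    have "sum snd (f ` \<W>) \<le> sum (snd \<circ> f) \<W>"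
      using \<W>(1,4) by (intro sum_image_le) (auto simp: f_def)
    also have "\<dots> \<le> W" using \<W>(3) by (simp add: f_def comp_def)
    finally show "sum snd (f ` \<W>) \<le> W" .
    show "0 \<le> snd p" if "p \<in> f ` \<W>" for p
      using that \<W>(4) by (auto simp: f_def)
    show "exp (\<Sum>a\<in>(+) t ` A. \<phi> ((T ^^ a) x)) \<le> snd p" if "p \<in> f ` \<W>" "x \<in> fst p" for p x
      using that \<W>(5) by (auto simp: f_def sum.reindex T_add)
    show "dist ((T ^^ a) x) ((T ^^ a) y) \<le> \<rho>"
      if "p \<in> f ` \<W>" "x \<in> fst p" "y \<in> fst p" "a \<in> (+) t ` A" for p x y a
      using that \<W>(6) by (auto simp: f_def T_add)
  qed
qed

text \<open>Pick one point in each piece. Its exponential is dominated by the weight of the piece,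
  and the diameter bound makes it close to all other points there.\<close>

lemma orbit_cover_centres:
  assumes "orbit_cover T \<phi> \<rho> X A W"
  obtains F where "finite F" "F \<subseteq> X" "(\<Sum>x\<in>F. exp (\<Sum>a\<in>A. \<phi> ((T ^^ a) x))) \<le> W"
    "\<And>x. x \<in> X \<Longrightarrow> \<exists>y\<in>F. \<forall>a\<in>A. dist ((T ^^ a) x) ((T ^^ a) y) \<le> \<rho>"
proof -
  obtain \<W> where \<W>: "finite \<W>" "X \<subseteq> \<Union> (fst ` \<W>)" "sum snd \<W> \<le> W"
    "\<And>p. p \<in> \<W> \<Longrightarrow> 0 \<le> snd p"
    "\<And>p x. p \<in> \<W> \<Longrightarrow> x \<in> fst p \<Longrightarrow> exp (\<Sum>a\<in>A. \<phi> ((T ^^ a) x)) \<le> snd p"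
    "\<And>p x y a. p \<in> \<W> \<Longrightarrow> x \<in> fst p \<Longrightarrow> y \<in> fst p \<Longrightarrow> a \<in> A \<Longrightarrow>
           dist ((T ^^ a) x) ((T ^^ a) y) \<le> \<rho>"
    using assms by (rule orbit_coverE) blast
  \<comment> \<open>Pieces need not lie in \<open>X\<close>; only those meeting it can supply a
    centre, and discarding the rest does not increase the total weight.\<close>
  define \<V> where "\<V> = {p \<in> \<W>. fst p \<inter> X \<noteq> {}}"
  define c where "c p = (SOME x. x \<in> fst p \<inter> X)" for p :: "'a set \<times> real"
  have c: "c p \<in> fst p \<inter> X" if "p \<in> \<V>" for p
    unfolding c_def by (rule someI_ex) (use that in \<open>auto simp: \<V>_def\<close>)
  have fin: "finite \<V>" using \<W>(1) by (simp add: \<V>_def)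
  show ?thesis
  proof
    show "finite (c ` \<V>)" using fin by simp
    show "c ` \<V> \<subseteq> X" using c by auto
    have "(\<Sum>x\<in>c ` \<V>. exp (\<Sum>a\<in>A. \<phi> ((T ^^ a) x)))
        \<le> sum ((\<lambda>x. exp (\<Sum>a\<in>A. \<phi> ((T ^^ a) x))) \<circ> c) \<V>"
      using fin by (intro sum_image_le) auto
    also have "\<dots> \<le> sum snd \<V>"
      using c \<W>(5) by (intro sum_mono) (auto simp: \<V>_def)
    also have "\<dots> \<le> sum snd \<W>"
      using \<W>(1,4) by (intro sum_mono2) (auto simp: \<V>_def)
    finally show "(\<Sum>x\<in>c ` \<V>. exp (\<Sum>a\<in>A. \<phi> ((T ^^ a) x))) \<le> W" using \<W>(3) by linarith
    fix x assume "x \<in> X"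
    then obtain p where p: "p \<in> \<W>" "x \<in> fst p" using \<W>(2) by blast
    then have "p \<in> \<V>" using \<open>x \<in> X\<close> by (auto simp: \<V>_def)
    then show "\<exists>y\<in>c ` \<V>. \<forall>a\<in>A. dist ((T ^^ a) x) ((T ^^ a) y) \<le> \<rho>"
      using p c \<W>(6) by blast
  qed
qed

text \<open>Take a finite \<open>\<rho> / 2\<close>-net of \<open>X\<close> and pull its balls back
  under \<open>T ^^ a\<close>. The net does not depend on \<open>a\<close>, so one constant serves
  all times. It is raised to at least 1 so that \<open>ln C\<close> is nonnegative.\<close>

lemma orbit_cover_single_time:
  fixes X :: "'a::metric_space set"
  assumes X: "compact X" "T ` X \<subseteq> X" and \<phi>: "\<And>x. x \<in> X \<Longrightarrow> \<phi> x \<le> M" and "0 < \<rho>"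
  obtains C where "1 \<le> C" "\<And>a Y. Y \<subseteq> X \<Longrightarrow> orbit_cover T \<phi> \<rho> Y {a} C"
proof -
  have Xr: "X \<subseteq> (\<Union>x\<in>X. ball x (\<rho> / 2))" using \<open>0 < \<rho>\<close> by auto
  obtain K where K: "K \<subseteq> X" "finite K" "X \<subseteq> (\<Union>x\<in>K. ball x (\<rho> / 2))"
    by (rule compactE_image[OF X(1) _ Xr]) auto
  have TX: "(T ^^ a) x \<in> X" if "x \<in> X" for a x
    using X(2) that by (rule funpow_mem)
  show ?thesis
  proof
    show "1 \<le> max 1 (real (card K) * exp M)" by simp
    fix a Y assume Y: "Y \<subseteq> X"
    have "orbit_cover T \<phi> \<rho> (\<Union>z\<in>K. {y\<in>X. dist ((T ^^ a) y) z \<le> \<rho> / 2}) {a} (\<Sum>z\<in>K. exp M)"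
      using K(2) \<phi> TX by (intro orbit_cover_UN orbit_cover_singleton) auto
    then show "orbit_cover T \<phi> \<rho> Y {a} (max 1 (real (card K) * exp M))"
    proof (rule orbit_cover_mono)
      show "Y \<subseteq> (\<Union>z\<in>K. {y\<in>X. dist ((T ^^ a) y) z \<le> \<rho> / 2})"
      proof
        fix y assume "y \<in> Y"
        then have "y \<in> X" "(T ^^ a) y \<in> X" using Y TX by auto
        then obtain z where "z \<in> K" "dist z ((T ^^ a) y) < \<rho> / 2" using K(3) by force
        then show "y \<in> (\<Union>z\<in>K. {y\<in>X. dist ((T ^^ a) y) z \<le> \<rho> / 2})"
          using \<open>y \<in> X\<close> by (auto simp: dist_commute intro: less_imp_le)
      qed
    qed simp
  qed
qed

section \<open>Matches and FK balls\<close>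

text \<open>Either map lists \<open>R\<close> in increasing order along the sorted list of
  \<open>D\<close>. Thus a match is determined by its domain and range, and counting matches reduces
  to counting pairs of sets.\<close>

lemma strict_mono_on_bij_betw_unique:
  fixes D R :: "nat set"
  assumes "finite D" "strict_mono_on D f" "strict_mono_on D g"
    and "bij_betw f D R" "bij_betw g D R" "i \<in> D"
  shows "f i = g i"
proof -
  let ?l = "sorted_list_of_set D"
  have *: "sorted (map h ?l) \<and> distinct (map h ?l) \<and> set (map h ?l) = R"
    if "strict_mono_on D h" "bij_betw h D R" for h :: "nat \<Rightarrow> nat"
  proof (intro conjI)
    show "sorted (map h ?l)"
      unfolding sorted_map
      by (rule sorted_wrt_mono_rel[of _ "(\<le>)"])
        (use assms(1) strict_mono_on_leD[OF that(1)] in auto)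
    show "distinct (map h ?l)" "set (map h ?l) = R"
      using that(2) assms(1) by (auto simp: bij_betw_def distinct_map)
  qed
  have "map f ?l = map g ?l"
    using *[OF assms(2,4)] *[OF assms(3,5)] by (intro sorted_distinct_set_unique) auto
  then show ?thesis using assms(1,6) by simp
qed

text \<open>Together with the empty match of \<open>fk_match_nonempty\<close>, this makes the
  \<open>Max\<close> in \<open>fk_defect\<close> an attained maximum.\<close>

lemma fk_match_finite: "finite {card D | D R \<pi>. fk_match T q n \<delta> x y D R \<pi>}"
proof (rule finite_subset)
  show "{card D | D R \<pi>. fk_match T q n \<delta> x y D R \<pi>} \<subseteq> {..n}"
  proof clarify
    fix D R \<pi> assume "fk_match T q n \<delta> x y D R \<pi>"
    then have "D \<subseteq> {..<n}" by (simp add: fk_match_def)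
    then show "card D \<le> n" using card_mono[of "{..<n}" D] by simp
  qed
qed simp

lemma fk_match_nonempty: "{card D | D R \<pi>. fk_match T q n \<delta> x y D R \<pi>} \<noteq> {}"
proof -
  have "fk_match T q n \<delta> x y {} {} id"
    by (simp add: fk_match_def)
  then show ?thesis
    unfolding ex_in_conv[symmetric] mem_Collect_eq by (intro exI conjI) (rule refl)
qed

lemma fk_dist_lessE:
  assumes "fk_dist T q n x y < \<epsilon>" "0 < n"
  obtains D R \<pi> where "fk_match T q n \<epsilon> x y D R \<pi>" "real n - real (card D) < \<epsilon> * n"
proof -
  let ?S = "\<lambda>\<delta>. {card D | D R \<pi>. fk_match T q n \<delta> x y D R \<pi>}"
  \<comment> \<open>A defect never exceeds 1, so 2 is admissible and the infimum in
    \<open>fk_dist\<close> is over a nonempty set.\<close>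
  have "fk_defect T q n 2 x y \<le> 1" by (simp add: fk_defect_def)
  then have "(2::real) \<in> {\<delta>. \<delta> > 0 \<and> fk_defect T q n \<delta> x y < \<delta>}" by simp
  then obtain \<delta> where \<delta>: "\<delta> > 0" "fk_defect T q n \<delta> x y < \<delta>" "\<delta> < \<epsilon>"
    using cInf_lessD[of "{\<delta>. \<delta> > 0 \<and> fk_defect T q n \<delta> x y < \<delta>}" \<epsilon>] assms(1)
    unfolding fk_dist_def by blast
  have "Max (?S \<delta>) \<in> ?S \<delta>"
    using fk_match_finite fk_match_nonempty by (rule Max_in)
  then obtain D R \<pi> where m: "fk_match T q n \<delta> x y D R \<pi>" "Max (?S \<delta>) = card D" by blast
  have "1 - real (card D) / real n < \<epsilon>"
    using \<delta> m(2) unfolding fk_defect_def by simp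
  then have "real n - real (card D) < \<epsilon> * n" using \<open>0 < n\<close> by (simp add: field_simps)
  moreover have "fk_match T q n \<epsilon> x y D R \<pi>"
    using m(1) \<delta>(3) unfolding fk_match_def by force
  ultimately show ?thesis using that by blast
qed

text \<open>The identity matches all \<open>n\<close> times, so the defect vanishes at every scale
  above \<open>\<rho>\<close>.\<close>

lemma fk_dist_lessI:
  assumes "\<And>i. i < n \<Longrightarrow> dist ((T ^^ (q * i)) x) ((T ^^ (q * i)) y) \<le> \<rho>"
    and "\<rho> < \<epsilon>" "0 < \<epsilon>" "0 < n"
  shows "fk_dist T q n x y < \<epsilon>"
proof -
  \<comment> \<open>Matches require strict closeness, so the scale lies strictly between
    \<open>\<rho>\<close> and \<open>\<epsilon>\<close>; \<open>max 0\<close> gives its positivity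
    directly.\<close>
  define \<delta> where "\<delta> = (max 0 \<rho> + \<epsilon>) / 2"
  have \<delta>: "\<rho> < \<delta>" "0 < \<delta>" "\<delta> < \<epsilon>" using assms(2,3) by (auto simp: \<delta>_def)
  let ?S = "{card D | D R \<pi>. fk_match T q n \<delta> x y D R \<pi>}"
  have "fk_match T q n \<delta> x y {..<n} {..<n} id"
    using assms(1) \<delta>(1) by (force simp: fk_match_def strict_mono_on_def)
  then have "card {..<n} \<in> ?S" by blast
  then have "card {..<n} \<le> Max ?S" by (rule Max_ge[OF fk_match_finite])
  then have "n \<le> Max ?S" by simp
  then have "fk_defect T q n \<delta> x y \<le> 0"
    using \<open>0 < n\<close> by (simp add: fk_defect_def)
  then have "fk_dist T q n x y \<le> \<delta>"
    unfolding fk_dist_def using \<delta>(2) by (intro cInf_lower bdd_belowI[of _ 0]) auto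
  then show ?thesis using \<delta>(3) by linarith
qed

section \<open>Covering and counting match classes\<close>

lemma sum_power_codim:
  fixes s :: real
  shows "(\<Sum>D\<in>Pow {..<n}. s ^ (n - card D)) = (1 + s) ^ n"
proof -
  \<comment> \<open>Expand the product: \<open>D\<close> is the set of factors from which 1 is
    chosen.\<close>
  have "(\<Prod>i\<in>{..<n}. 1 + s) = (\<Sum>D\<in>Pow {..<n}. (\<Prod>i\<in>D. 1) * (\<Prod>i\<in>{..<n} - D. s))"
    by (rule prod_add) simp
  also have "\<dots> = (\<Sum>D\<in>Pow {..<n}. s ^ (n - card D))"
    by (rule sum.cong) (auto simp: card_Diff_subset finite_subset)
  finally show ?thesis by simp
qed

text \<open>
  A matched time j costs the value of the potential at the partner time of j in the orbit of x;
  each of the few unmatched times costs the constant C, plus M for the term of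
  the Birkhoff sum of x that is not used.
\<close>

lemma orbit_cover_match_class:
  assumes TX: "T ` X \<subseteq> X" and x: "x \<in> X"
    and C: "\<And>a Y. Y \<subseteq> X \<Longrightarrow> orbit_cover T \<phi> \<rho> Y {a} C" "1 \<le> C"
    and M: "\<And>z. z \<in> X \<Longrightarrow> - M \<le> \<phi> z"
    and v: "\<And>u w. u \<in> X \<Longrightarrow> w \<in> X \<Longrightarrow> dist u w < \<epsilon> \<Longrightarrow> \<phi> w \<le> \<phi> u + v" "0 \<le> v"
    and \<epsilon>: "\<epsilon> \<le> \<rho> / 2" and q: "0 < q"
  shows "orbit_cover T \<phi> \<rho> {y\<in>X. \<exists>\<pi>. fk_match T q n \<epsilon> x y D R \<pi>} ((*) q ` {..<n})
           (exp (birkhoff_sum T q n \<phi> x + n * v) * (C * exp M) ^ (n - card R))"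
\<comment> \<open>In an empty class \<open>D\<close> and \<open>R\<close> are arbitrary sets; any
  member of the class forces both into \<open>{..<n}\<close> and supplies the bijection.\<close>
proof (cases "{y\<in>X. \<exists>\<pi>. fk_match T q n \<epsilon> x y D R \<pi>} = {}")
  case True
  show ?thesis unfolding True using C(2) by (intro orbit_cover_no_points) simp
next
  case False
  let ?Y = "{y\<in>X. \<exists>\<pi>. fk_match T q n \<epsilon> x y D R \<pi>}"
  obtain y0 \<pi> where "fk_match T q n \<epsilon> x y0 D R \<pi>" using False by blast
  then have DR: "D \<subseteq> {..<n}" "R \<subseteq> {..<n}" and bij: "bij_betw \<pi> D R" and mono: "strict_mono_on D \<pi>"
    by (auto simp: fk_match_def)
  have fin: "finite D" "finite R" using DR finite_subset by blast+
  have card: "card D = card R" using bij by (rule bij_betw_same_card)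
  define \<sigma> where "\<sigma> = inv_into D \<pi>"
  have bij': "bij_betw \<sigma> R D" unfolding \<sigma>_def using bij by (rule bij_betw_inv_into)
  have near: "dist ((T ^^ (q * \<sigma> j)) x) ((T ^^ (q * j)) y) < \<epsilon>" if "j \<in> R" "y \<in> ?Y" for j y
  proof -
    obtain \<pi>' where m: "fk_match T q n \<epsilon> x y D R \<pi>'" using \<open>y \<in> ?Y\<close> by blast
    have D: "\<sigma> j \<in> D" using bij' \<open>j \<in> R\<close> by (auto simp: bij_betw_def)
    \<comment> \<open>The match of \<open>y\<close> may be another one than \<open>\<pi>\<close>,
      but by uniqueness they agree on \<open>D\<close>. Hence at a time in \<open>R\<close> all
      points of the class follow the same point of the orbit of \<open>x\<close>.\<close>
    have "\<pi>' (\<sigma> j) = \<pi> (\<sigma> j)"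
      using m fin(1) mono bij D
      by (intro strict_mono_on_bij_betw_unique[of D]) (auto simp: fk_match_def)
    also have "\<dots> = j"
      unfolding \<sigma>_def using bij \<open>j \<in> R\<close> by (rule bij_betw_inv_into_right)
    finally show ?thesis using m D unfolding fk_match_def by metis
  qed
  define w where "w j = (if j \<in> R then exp (\<phi> ((T ^^ (q * \<sigma> j)) x) + v) else C)" for j
  have cover: "orbit_cover T \<phi> \<rho> ?Y ((*) q ` {..<n}) (\<Prod>j<n. w j)"
  proof (rule orbit_cover_prod)
    show "inj_on ((*) q) {..<n}" using q by (simp add: inj_on_def)
    show "orbit_cover T \<phi> \<rho> ?Y {q * j} (w j)" for j
    proof (cases "j \<in> R")
      case True
      have "orbit_cover T \<phi> \<rho> ?Y {q * j} (exp (\<phi> ((T ^^ (q * \<sigma> j)) x) + v))"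
      proof (rule orbit_cover_singleton)
        fix y assume y: "y \<in> ?Y"
        show "dist ((T ^^ (q * j)) y) ((T ^^ (q * \<sigma> j)) x) \<le> \<rho> / 2"
          using near[OF True y] \<epsilon> by (simp add: dist_commute)
        show "\<phi> ((T ^^ (q * j)) y) \<le> \<phi> ((T ^^ (q * \<sigma> j)) x) + v"
          using y x near[OF True y] by (intro v(1) funpow_mem[OF TX]) auto
      qed
      then show ?thesis using True by (simp add: w_def)
    qed (auto simp: w_def intro: C(1))
  qed simp
  \<comment> \<open>The weights at matched times only see the terms of the Birkhoff sum of
    \<open>x\<close> at times in \<open>D\<close>. Each omitted term is at least \<open>- M\<close>,
    which is the origin of the factor \<open>exp M\<close> per unmatched time.\<close>
  have sumD: "(\<Sum>i\<in>D. \<phi> ((T ^^ (q * i)) x)) \<le> birkhoff_sum T q n \<phi> x + real (n - card R) * M"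
  proof -
    have "birkhoff_sum T q n \<phi> x
        = (\<Sum>i\<in>D. \<phi> ((T ^^ (q * i)) x)) + (\<Sum>i\<in>{..<n} - D. \<phi> ((T ^^ (q * i)) x))"
      unfolding birkhoff_sum_def using DR(1) by (subst sum.subset_diff[of D]) auto
    moreover have "(\<Sum>i\<in>{..<n} - D. - M) \<le> (\<Sum>i\<in>{..<n} - D. \<phi> ((T ^^ (q * i)) x))"
      by (intro sum_mono M funpow_mem[OF TX x])
    ultimately show ?thesis using DR(1) fin card by (simp add: card_Diff_subset)
  qed
  have "(\<Prod>j<n. w j) = (\<Prod>j\<in>R. w j) * (\<Prod>j\<in>{..<n} - R. w j)"
    using DR(2) by (subst prod.subset_diff[of R]) auto
  also have "(\<Prod>j\<in>R. w j) = exp (\<Sum>j\<in>R. \<phi> ((T ^^ (q * \<sigma> j)) x) + v)"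
    by (simp add: w_def exp_sum fin)
  also have "(\<Sum>j\<in>R. \<phi> ((T ^^ (q * \<sigma> j)) x) + v) = (\<Sum>i\<in>D. \<phi> ((T ^^ (q * i)) x)) + card R * v"
    using sum.reindex_bij_betw[OF bij', of "\<lambda>i. \<phi> ((T ^^ (q * i)) x)"] by (simp add: sum.distrib)
  also have "(\<Prod>j\<in>{..<n} - R. w j) = C ^ (n - card R)"
    using DR(2) fin by (simp add: w_def card_Diff_subset)
  also have "exp ((\<Sum>i\<in>D. \<phi> ((T ^^ (q * i)) x)) + card R * v) * C ^ (n - card R)
      \<le> exp (birkhoff_sum T q n \<phi> x + real (n - card R) * M + n * v) * C ^ (n - card R)"
  proof -
    have "card R \<le> n" using DR(2) card_mono[of "{..<n}" R] by simp
    then have "real (card R) * v \<le> n * v" using v(2) by (intro mult_right_mono) auto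
    then show ?thesis using sumD C(2) by (intro mult_right_mono) auto
  qed
  also have "\<dots> = exp (birkhoff_sum T q n \<phi> x + n * v) * (C * exp M) ^ (n - card R)"
    by (simp add: exp_add power_mult_distrib exp_of_nat_mult)
  finally show ?thesis by (rule orbit_cover_mono[OF cover order_refl])
qed

text \<open>
  Growth rate of the number of possible match domains and ranges, unmatched times of the range
  being weighted by K. Inserting \<open>1 \<le> \<epsilon> powr (t - \<epsilon> * n)\<close> for a
  defect \<open>t < \<epsilon> * n\<close> turns the count into a binomial sum and replaces Stirling's formula.
\<close>

definition match_growth :: "real \<Rightarrow> real \<Rightarrow> real" where
  "match_growth K \<epsilon> = (\<epsilon> powr - \<epsilon>) ^ 2 * (1 + \<epsilon>) * (1 + \<epsilon> * K)"

lemma match_growth_tendsto: "((\<lambda>\<epsilon>. match_growth K \<epsilon>) \<longlongrightarrow> 1) (at_right 0)"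
  unfolding match_growth_def by real_asymp

lemma powr_defect_ge_1:
  assumes "0 < \<epsilon>" "\<epsilon> \<le> 1" "real t < \<epsilon> * real n"
  shows "1 \<le> (\<epsilon> powr - \<epsilon>) ^ n * \<epsilon> ^ t"
proof -
  have "(\<epsilon> powr - \<epsilon>) ^ n * \<epsilon> ^ t = \<epsilon> powr (real t - \<epsilon> * n)"
    using assms(1) by (simp add: powr_realpow[symmetric] powr_powr powr_add[symmetric] algebra_simps)
  moreover have "\<epsilon> powr 0 \<le> \<epsilon> powr (real t - \<epsilon> * n)"
    using assms by (intro powr_mono') auto
  ultimately show ?thesis using assms(1) by simp
qed

text \<open>The domain and the range have the same defect, and a factor at least 1 is inserted for
  each; this explains the square in \<open>match_growth\<close>. Without the constraints the sum
  over pairs splits into two binomial sums.\<close>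

lemma sum_match_classes_le:
  fixes \<epsilon> :: real
  assumes \<epsilon>: "0 < \<epsilon>" "\<epsilon> \<le> 1" and K: "0 \<le> K"
    and I: "I = {(D, R). D \<subseteq> {..<n} \<and> R \<subseteq> {..<n} \<and> card D = card R \<and>
                  real (n - card D) < \<epsilon> * n}"
  shows "(\<Sum>(D, R)\<in>I. K ^ (n - card R)) \<le> match_growth K \<epsilon> ^ n"
proof -
  let ?P = "Pow {..<n}"
  define b where "b = \<epsilon> powr - \<epsilon>"
  have "b \<ge> 0" by (simp add: b_def)
  have "(\<Sum>(D, R)\<in>I. K ^ (n - card R))
      \<le> (\<Sum>(D, R)\<in>I. (b ^ n * \<epsilon> ^ (n - card D)) * (b ^ n * (\<epsilon> * K) ^ (n - card R)))"
  proof (rule sum_mono, clarify)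
    fix D R assume "(D, R) \<in> I"
    then have "1 \<le> b ^ n * \<epsilon> ^ (n - card D)" "1 \<le> b ^ n * \<epsilon> ^ (n - card R)"
      unfolding b_def I using \<epsilon> by (auto intro!: powr_defect_ge_1)
    then have "1 * 1 \<le> (b ^ n * \<epsilon> ^ (n - card D)) * (b ^ n * \<epsilon> ^ (n - card R))"
      by (intro mult_mono) auto
    then have "1 * K ^ (n - card R)
        \<le> (b ^ n * \<epsilon> ^ (n - card D)) * (b ^ n * \<epsilon> ^ (n - card R)) * K ^ (n - card R)"
      using K by (intro mult_right_mono) auto
    then show "K ^ (n - card R)
        \<le> (b ^ n * \<epsilon> ^ (n - card D)) * (b ^ n * (\<epsilon> * K) ^ (n - card R))"
      by (simp add: power_mult_distrib mult_ac)
  qed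
  also have "\<dots> \<le> (\<Sum>(D, R)\<in>?P \<times> ?P.
      (b ^ n * \<epsilon> ^ (n - card D)) * (b ^ n * (\<epsilon> * K) ^ (n - card R)))"
    using \<epsilon> K \<open>b \<ge> 0\<close> by (intro sum_mono2) (auto simp: I)
  also have "\<dots> = (\<Sum>D\<in>?P. b ^ n * \<epsilon> ^ (n - card D)) * (\<Sum>R\<in>?P. b ^ n * (\<epsilon> * K) ^ (n - card R))"
    by (simp add: sum_product sum.cartesian_product)
  also have "\<dots> = match_growth K \<epsilon> ^ n"
    unfolding sum_distrib_left[symmetric] sum_power_codim
    by (simp add: match_growth_def b_def power_mult_distrib power2_eq_square)
  finally show ?thesis .
qed

text \<open>The ball is the union of its match classes, indexed by pairs of sets of equal size and
  small defect. The loss is a factor to the power \<open>n\<close> that depends on neither the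
  centre nor \<open>q\<close>.\<close>

lemma orbit_cover_fk_ball:
  assumes TX: "T ` X \<subseteq> X" and x: "x \<in> X"
    and C: "\<And>a Y. Y \<subseteq> X \<Longrightarrow> orbit_cover T \<phi> \<rho> Y {a} C" "1 \<le> C"
    and M: "\<And>z. z \<in> X \<Longrightarrow> - M \<le> \<phi> z"
    and v: "\<And>u w. u \<in> X \<Longrightarrow> w \<in> X \<Longrightarrow> dist u w < \<epsilon> \<Longrightarrow> \<phi> w \<le> \<phi> u + v" "0 \<le> v"
    and \<epsilon>: "0 < \<epsilon>" "\<epsilon> \<le> 1" "\<epsilon> \<le> \<rho> / 2" and q: "0 < q" and n: "0 < n"
  shows "orbit_cover T \<phi> \<rho> (fk_ball X T q n x \<epsilon>) ((*) q ` {..<n})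
           ((exp v * match_growth (C * exp M) \<epsilon>) ^ n * exp (birkhoff_sum T q n \<phi> x))"
proof -
  let ?K = "C * exp M" and ?S = "birkhoff_sum T q n \<phi> x"
  let ?Y = "\<lambda>D R. {y\<in>X. \<exists>\<pi>. fk_match T q n \<epsilon> x y D R \<pi>}"
  define I where "I = {(D, R). D \<subseteq> {..<n} \<and> R \<subseteq> {..<n} \<and> card D = card R \<and>
                    real (n - card D) < \<epsilon> * n}"
  have "finite I"
    by (rule finite_subset[of _ "Pow {..<n} \<times> Pow {..<n}"]) (auto simp: I_def)
  have cover: "orbit_cover T \<phi> \<rho> (\<Union>p\<in>I. ?Y (fst p) (snd p)) ((*) q ` {..<n})
      (\<Sum>p\<in>I. exp (?S + n * v) * ?K ^ (n - card (snd p)))"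
    using assms \<open>finite I\<close> by (intro orbit_cover_UN orbit_cover_match_class) auto
  show ?thesis
  proof (rule orbit_cover_mono[OF cover])
    show "fk_ball X T q n x \<epsilon> \<subseteq> (\<Union>p\<in>I. ?Y (fst p) (snd p))"
    proof
      fix y assume "y \<in> fk_ball X T q n x \<epsilon>"
      then have y: "y \<in> X" "fk_dist T q n x y < \<epsilon>" by (auto simp: fk_ball_def)
      obtain D R \<pi> where m: "fk_match T q n \<epsilon> x y D R \<pi>" "real n - real (card D) < \<epsilon> * n"
        using fk_dist_lessE[OF y(2) n] by blast
      have "card D \<le> n" using m(1) card_mono[of "{..<n}" D] by (simp add: fk_match_def)
      then have "(D, R) \<in> I"
        using m by (auto simp: I_def fk_match_def of_nat_diff dest: bij_betw_same_card)
      then show "y \<in> (\<Union>p\<in>I. ?Y (fst p) (snd p))" using y(1) m(1) by force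
    qed
    have "(\<Sum>p\<in>I. exp (?S + n * v) * ?K ^ (n - card (snd p)))
        = exp (?S + n * v) * (\<Sum>(D, R)\<in>I. ?K ^ (n - card R))"
      by (simp add: sum_distrib_left case_prod_unfold)
    also have "\<dots> \<le> exp (?S + n * v) * match_growth ?K \<epsilon> ^ n"
      using \<epsilon> C(2) by (intro mult_left_mono sum_match_classes_le[OF _ _ _ I_def]) auto
    also have "\<dots> = (exp v * match_growth ?K \<epsilon>) ^ n * exp ?S"
      by (simp add: exp_add power_mult_distrib exp_of_nat_mult)
    finally show "(\<Sum>p\<in>I. exp (?S + n * v) * ?K ^ (n - card (snd p)))
        \<le> (exp v * match_growth ?K \<epsilon>) ^ n * exp ?S" .
  qed
qed

section \<open>Pressure bounds from a single cover\<close>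

lemma bowen_dist_le_iff:
  assumes "0 < n"
  shows "bowen_dist T n x y \<le> \<rho> \<longleftrightarrow> (\<forall>i<n. dist ((T ^^ i) x) ((T ^^ i) y) \<le> \<rho>)"
proof -
  have "{..<n} \<noteq> {}" using assms by blast
  then show ?thesis unfolding bowen_dist_def by (subst Max_le_iff) auto
qed

lemma orbit_cover_spanning_set:
  assumes "orbit_cover T \<phi> \<rho> X {..<m} W" "0 < m"
  obtains F where "spanning_set X T m \<rho> F" "(\<Sum>x\<in>F. exp (birkhoff_sum T 1 m \<phi> x)) \<le> W"
proof -
  obtain F where F: "finite F" "F \<subseteq> X" "(\<Sum>x\<in>F. exp (\<Sum>a<m. \<phi> ((T ^^ a) x))) \<le> W"
    "\<And>x. x \<in> X \<Longrightarrow> \<exists>y\<in>F. \<forall>a\<in>{..<m}. dist ((T ^^ a) x) ((T ^^ a) y) \<le> \<rho>"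
    by (rule orbit_cover_centres[OF assms(1)]) blast
  have "spanning_set X T m \<rho> F"
    unfolding spanning_set_def bowen_dist_le_iff[OF assms(2)] using F(1,2,4) by blast
  then show ?thesis using F(3) that by (simp add: birkhoff_sum_def)
qed

lemma spanning_pressure_le:
  assumes "orbit_cover T \<phi> \<rho> X {..<m} W" "0 < m"
  shows "spanning_pressure X T \<phi> m \<rho> \<le> W"
proof -
  obtain F where F: "spanning_set X T m \<rho> F" "(\<Sum>x\<in>F. exp (birkhoff_sum T 1 m \<phi> x)) \<le> W"
    using orbit_cover_spanning_set[OF assms] .
  have "spanning_pressure X T \<phi> m \<rho> \<le> (\<Sum>x\<in>F. exp (birkhoff_sum T 1 m \<phi> x))"
    unfolding spanning_pressure_def using F(1)
    by (intro cInf_lower bdd_belowI[of _ 0]) (auto intro: sum_nonneg)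
  then show ?thesis using F(2) by linarith
qed

lemma birkhoff_sum_ge:
  fixes M :: real
  assumes "T ` X \<subseteq> X" "x \<in> X" "\<And>z. z \<in> X \<Longrightarrow> - M \<le> \<phi> z"
  shows "- (n * M) \<le> birkhoff_sum T q n \<phi> x"
proof -
  have "(\<Sum>i<n. - M) \<le> birkhoff_sum T q n \<phi> x"
    unfolding birkhoff_sum_def by (intro sum_mono assms(3) funpow_mem[OF assms(1,2)])
  then show ?thesis by simp
qed

text \<open>A spanning set of a nonempty space has a point, whose term alone is at least
  \<open>exp (- (m * M))\<close>. The given spanning set keeps the infimum from being taken over the
  empty set.\<close>

lemma spanning_pressure_pos:
  fixes M :: real
  assumes "X \<noteq> {}" "T ` X \<subseteq> X" and M: "\<And>z. z \<in> X \<Longrightarrow> - M \<le> \<phi> z"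
    and "spanning_set X T m \<rho> F\<^sub>0"
  shows "0 < spanning_pressure X T \<phi> m \<rho>"
proof -
  have "exp (- (m * M)) \<le> spanning_pressure X T \<phi> m \<rho>"
    unfolding spanning_pressure_def
  proof (rule cInf_greatest)
    fix s assume "s \<in> {\<Sum>x\<in>F. exp (birkhoff_sum T 1 m \<phi> x) | F. spanning_set X T m \<rho> F}"
    then obtain F where F: "spanning_set X T m \<rho> F" "s = (\<Sum>x\<in>F. exp (birkhoff_sum T 1 m \<phi> x))"
      by blast
    then obtain x where x: "x \<in> F" "x \<in> X" "finite F"
      using \<open>X \<noteq> {}\<close> unfolding spanning_set_def by blast
    have "exp (- (m * M)) \<le> exp (birkhoff_sum T 1 m \<phi> x)"
      using birkhoff_sum_ge[OF assms(2) x(2) M] by simp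
    also have "\<dots> \<le> s" unfolding F(2) using x by (intro member_le_sum) auto
    finally show "exp (- (m * M)) \<le> s" .
  qed (use assms(4) in blast)
  then show ?thesis using exp_gt_zero less_le_trans by blast
qed

text \<open>
  An interval of n q times is the disjoint union of q translates of a progression of step q,
  which is why the step does not enter the bound for the pressure.
\<close>

lemma orbit_cover_blocks:
  assumes TX: "T ` X \<subseteq> X" and V: "orbit_cover T \<phi> \<rho> X ((*) q ` {..<n}) V"
  shows "orbit_cover T \<phi> \<rho> X {..<k * (n * q)} (V ^ (q * k))"
proof -
  have sub: "(T ^^ t) ` X \<subseteq> X" for t using funpow_mem[OF TX] by blast
  have "orbit_cover T \<phi> \<rho> X (\<Union>r<s. (+) r ` (*) q ` {..<n}) (V ^ s)" if "s \<le> q" for s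
    using that
  proof (induction s)
    case 0
    then show ?case by (simp add: orbit_cover_no_times)
  next
    case (Suc s)
    have "orbit_cover T \<phi> \<rho> X
        ((+) s ` (*) q ` {..<n} \<union> (\<Union>r<s. (+) r ` (*) q ` {..<n})) (V * V ^ s)"
    proof (rule orbit_cover_Un_times)
      \<comment> \<open>Translates by different \<open>r < q\<close> occupy different residues
        modulo \<open>q\<close>.\<close>
      have False if "r < s" "s + q * i = r + q * j" for r i j
      proof -
        have "(s + q * i) mod q = (r + q * j) mod q" using that(2) by simp
        then show False using that(1) Suc.prems by simp
      qed
      then show "(+) s ` (*) q ` {..<n} \<inter> (\<Union>r<s. (+) r ` (*) q ` {..<n}) = {}"
        by auto
    qed (use Suc V sub in \<open>auto intro: orbit_cover_shift\<close>)
    then show ?case by (simp add: lessThan_Suc)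
  qed
  from this[of q] have cover: "orbit_cover T \<phi> \<rho> X (\<Union>r<q. (+) r ` (*) q ` {..<n}) (V ^ q)" by simp
  have "(\<Union>r<q. (+) r ` (*) q ` {..<n}) = {..<n * q}"
  proof (intro equalityI subsetI)
    fix a assume "a \<in> (\<Union>r<q. (+) r ` (*) q ` {..<n})"
    then obtain r i where a: "a = r + q * i" "r < q" "i < n" by auto
    then have "a < q * Suc i" by simp
    also have "\<dots> \<le> q * n" using a by (intro mult_left_mono) auto
    finally show "a \<in> {..<n * q}" by (simp add: mult.commute)
  next
    fix a assume a: "a \<in> {..<n * q}"
    then have "0 < q" by (cases q) auto
    then have "a = a mod q + q * (a div q)" "a mod q < q" "a div q < n"
      using a by (auto simp: less_mult_imp_div_less)
    then show "a \<in> (\<Union>r<q. (+) r ` (*) q ` {..<n})" by blast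
  qed
  with cover have cover: "orbit_cover T \<phi> \<rho> X {..<n * q} (V ^ q)" by simp
  \<comment> \<open>Concatenate \<open>k\<close> blocks of \<open>n * q\<close> consecutive
    times.\<close>
  show ?thesis
  proof (induction k)
    case 0
    then show ?case by (simp add: orbit_cover_no_times)
  next
    case (Suc k)
    have "orbit_cover T \<phi> \<rho> X ({..<k * (n * q)} \<union> (+) (k * (n * q)) ` {..<n * q})
        (V ^ (q * k) * V ^ q)"
      using Suc sub cover by (intro orbit_cover_Un_times orbit_cover_shift[of _ _ _ X]) auto
    moreover have "{..<k * (n * q)} \<union> (+) (k * (n * q)) ` {..<n * q} = {..<Suc k * (n * q)}"
      by (simp add: lessThan_atLeast0 image_add_atLeastLessThan ivl_disj_un add.commute)
    ultimately show ?case by (simp add: power_add mult.commute)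
  qed
qed

text \<open>Write \<open>m = k * N + r\<close> with \<open>N = n * q\<close>: the blocks cost
  \<open>V ^ (q * k)\<close>, whose logarithm is \<open>(m - r) / n * ln V\<close>, and the fewer
  than \<open>N\<close> remaining times cost \<open>C\<close> each. The error in the logarithm is
  bounded independently of \<open>m\<close>, hence vanishes after division by
  \<open>m\<close>.\<close>

lemma limsup_spanning_pressure_le:
  assumes "X \<noteq> {}" and TX: "T ` X \<subseteq> X" and M: "\<And>z. z \<in> X \<Longrightarrow> - M \<le> \<phi> z"
    and C: "\<And>a Y. Y \<subseteq> X \<Longrightarrow> orbit_cover T \<phi> \<rho> Y {a} C" "1 \<le> C"
    and V: "orbit_cover T \<phi> \<rho> X ((*) q ` {..<n}) V" "0 < V" and "0 < q" "0 < n"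
  shows "limsup (\<lambda>m. ereal (1 / real m * ln (spanning_pressure X T \<phi> m \<rho>))) \<le> ereal (ln V / n)"
proof -
  define N where "N = n * q"
  have N: "0 < N" using assms by (simp add: N_def)
  \<comment> \<open>The absolute value is there because \<open>ln V\<close> can have either
    sign.\<close>
  define B where "B = real N / n * \<bar>ln V\<bar> + N * ln C"
  have bound: "1 / real m * ln (spanning_pressure X T \<phi> m \<rho>) \<le> ln V / n + B / m" if "0 < m" for m
  proof -
    define k r where "k = m div N" and "r = m mod N"
    have m: "m = k * N + r" "r < N" using N by (auto simp: k_def r_def)
    have "orbit_cover T \<phi> \<rho> X ((\<lambda>j. j) ` {k * N..<m}) (\<Prod>j\<in>{k * N..<m}. C)"
      using C by (intro orbit_cover_prod) auto
    then have "orbit_cover T \<phi> \<rho> X ({..<k * N} \<union> {k * N..<m}) (V ^ (q * k) * C ^ r)"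
      using orbit_cover_blocks[OF TX V(1), of k] m(1)
      by (intro orbit_cover_Un_times) (auto simp: N_def)
    moreover have "{..<k * N} \<union> {k * N..<m} = {..<m}" using m(1) by auto
    ultimately have cover: "orbit_cover T \<phi> \<rho> X {..<m} (V ^ (q * k) * C ^ r)" by simp
    obtain F where "spanning_set X T m \<rho> F"
      using orbit_cover_spanning_set[OF cover \<open>0 < m\<close>] by blast
    then have "ln (spanning_pressure X T \<phi> m \<rho>) \<le> ln (V ^ (q * k) * C ^ r)"
      using spanning_pressure_le[OF cover that] spanning_pressure_pos[OF assms(1) TX M] V C(2)
      by (subst ln_le_cancel_iff) auto
    also have "\<dots> = q * k * ln V + r * ln C"
      using V(2) C(2) by (simp add: ln_mult ln_realpow)
    also have "real (q * k) * ln V = m / n * ln V - r / n * ln V"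
      using m(1) \<open>0 < n\<close> by (simp add: N_def field_simps)
    also have "m / n * ln V - r / n * ln V + r * ln C \<le> m / n * ln V + B"
    proof -
      have "- (r / n * ln V) \<le> r / n * \<bar>ln V\<bar>"
        using abs_ge_minus_self[of "r / n * ln V"] by (simp add: abs_mult)
      also have "\<dots> \<le> real N / n * \<bar>ln V\<bar>"
        using m(2) by (intro mult_right_mono divide_right_mono) auto
      finally have "- (r / n * ln V) \<le> real N / n * \<bar>ln V\<bar>" .
      moreover have "r * ln C \<le> N * ln C" using m(2) C(2) by (intro mult_right_mono) auto
      ultimately show ?thesis by (simp add: B_def)
    qed
    finally show ?thesis using that by (simp add: field_simps)
  qed
  have "(\<lambda>m. ln V / n + B / real m) \<longlonglongrightarrow> ln V / n + 0"
    by (intro tendsto_add tendsto_const lim_const_over_n)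
  then have lim: "(\<lambda>m. ereal (ln V / n + B / real m)) \<longlonglongrightarrow> ereal (ln V / n)" by simp
  have "limsup (\<lambda>m. ereal (1 / real m * ln (spanning_pressure X T \<phi> m \<rho>)))
      \<le> limsup (\<lambda>m. ereal (ln V / n + B / real m))"
    by (rule Limsup_mono) (use bound in \<open>auto intro!: eventually_mono[OF eventually_gt_at_top[of 0]]\<close>)
  also have "\<dots> = ereal (ln V / n)"
    using lim by (intro lim_imp_Limsup) auto
  finally show ?thesis .
qed

section \<open>Comparison with the FK sums\<close>

definition fk_cover_sums ::
    "'a::metric_space set \<Rightarrow> ('a \<Rightarrow> 'a) \<Rightarrow> ('a \<Rightarrow> real) \<Rightarrow> nat \<Rightarrow> nat \<Rightarrow> real \<Rightarrow> real set" where
  "fk_cover_sums X T \<phi> q n \<epsilon> =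
     {\<Sum>i=1..k. exp (birkhoff_sum T q n \<phi> (x i)) | (k::nat) x.
        (\<forall>i\<in>{1..k}. x i \<in> X) \<and> (\<Union>i\<in>{1..k}. fk_ball X T q n (x i) \<epsilon>) = X}"

lemma fk_cover_sumsE:
  assumes "s \<in> fk_cover_sums X T \<phi> q n \<epsilon>"
  obtains k x where "s = (\<Sum>i=1..k::nat. exp (birkhoff_sum T q n \<phi> (x i)))"
    "\<forall>i\<in>{1..k}. x i \<in> X" "(\<Union>i\<in>{1..k}. fk_ball X T q n (x i) \<epsilon>) = X"
  using assms unfolding fk_cover_sums_def mem_Collect_eq by (elim exE conjE)

lemma fk_cover_sum_eq_Inf: "fk_cover_sum X T \<phi> q n \<epsilon> = Inf (fk_cover_sums X T \<phi> q n \<epsilon>)"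
  by (simp add: fk_cover_sum_def fk_cover_sums_def)

text \<open>Bowen closeness along the progression gives FK closeness through the identity match. The
  finite set is enumerated because FK covers are indexed by \<open>{1..k}\<close>.\<close>

lemma fk_cover_sumsI:
  assumes "finite F" "F \<subseteq> X" "\<rho> < \<epsilon>" "0 < \<epsilon>" "0 < n"
    and F: "\<And>x. x \<in> X \<Longrightarrow> \<exists>y\<in>F. \<forall>i<n. dist ((T ^^ (q * i)) x) ((T ^^ (q * i)) y) \<le> \<rho>"
  shows "(\<Sum>x\<in>F. exp (birkhoff_sum T q n \<phi> x)) \<in> fk_cover_sums X T \<phi> q n \<epsilon>"
proof -
  obtain h k where h: "bij_betw h {1..k::nat} F"
    using ex_bij_betw_nat_finite_1[OF assms(1)] by blast
  have img: "h ` {1..k} = F" using h by (simp add: bij_betw_def)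
  have "(\<Union>y\<in>F. fk_ball X T q n y \<epsilon>) = X"
  proof (intro equalityI subsetI)
    fix x assume x: "x \<in> X"
    then obtain y where y: "y \<in> F" "\<forall>i<n. dist ((T ^^ (q * i)) x) ((T ^^ (q * i)) y) \<le> \<rho>"
      using F by blast
    then have "fk_dist T q n y x < \<epsilon>"
      using assms by (intro fk_dist_lessI[of n q T y x \<rho>]) (auto simp: dist_commute)
    then show "x \<in> (\<Union>y\<in>F. fk_ball X T q n y \<epsilon>)" using x y(1) by (auto simp: fk_ball_def)
  qed (auto simp: fk_ball_def)
  then have "(\<Union>i\<in>{1..k}. fk_ball X T q n (h i) \<epsilon>) = X"
    unfolding img[symmetric] by (simp only: image_image)
  moreover have "\<forall>i\<in>{1..k}. h i \<in> X" using img assms(2) by auto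
  moreover have "(\<Sum>x\<in>F. exp (birkhoff_sum T q n \<phi> x))
      = (\<Sum>i=1..k. exp (birkhoff_sum T q n \<phi> (h i)))"
    by (rule sum.reindex_bij_betw[OF h, symmetric])
  ultimately show ?thesis
    unfolding fk_cover_sums_def mem_Collect_eq by (intro exI[of _ k] exI[of _ h]) simp
qed

section \<open>Nonemptiness and lower bounds for the infima\<close>

lemma orbit_cover_progression:
  assumes C: "\<And>a Y. Y \<subseteq> X \<Longrightarrow> orbit_cover T \<phi> \<rho> Y {a} C" and "0 < q"
  shows "orbit_cover T \<phi> \<rho> X ((*) q ` {..<n}) (C ^ n)"
proof -
  have "orbit_cover T \<phi> \<rho> X ((*) q ` {..<n}) (\<Prod>i<n. C)"
    using assms by (intro orbit_cover_prod) (auto simp: inj_on_def)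
  then show ?thesis by simp
qed

lemma fk_cover_sums_nonempty:
  assumes X: "compact X" "T ` X \<subseteq> X" and M: "\<And>z. z \<in> X \<Longrightarrow> \<phi> z \<le> M"
    and "0 < \<epsilon>" "0 < q" "0 < n"
  shows "fk_cover_sums X T \<phi> q n \<epsilon> \<noteq> {}"
proof -
  obtain C where C: "1 \<le> C" "\<And>a Y. Y \<subseteq> X \<Longrightarrow> orbit_cover T \<phi> (\<epsilon> / 2) Y {a} C"
    by (rule orbit_cover_single_time[where \<rho> = "\<epsilon> / 2", OF X M]) (use \<open>0 < \<epsilon>\<close> in auto)
  have "orbit_cover T \<phi> (\<epsilon> / 2) X ((*) q ` {..<n}) (C ^ n)"
    using C(2) \<open>0 < q\<close> by (rule orbit_cover_progression)
  then obtain F where F: "finite F" "F \<subseteq> X"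
    "\<And>x. x \<in> X \<Longrightarrow> \<exists>y\<in>F. \<forall>a\<in>(*) q ` {..<n}. dist ((T ^^ a) x) ((T ^^ a) y) \<le> \<epsilon> / 2"
    by (rule orbit_cover_centres) blast
  have "(\<Sum>x\<in>F. exp (birkhoff_sum T q n \<phi> x)) \<in> fk_cover_sums X T \<phi> q n \<epsilon>"
  proof (rule fk_cover_sumsI[where \<rho> = "\<epsilon> / 2"])
    fix x assume "x \<in> X"
    then show "\<exists>y\<in>F. \<forall>i<n. dist ((T ^^ (q * i)) x) ((T ^^ (q * i)) y) \<le> \<epsilon> / 2"
      using F(3) by blast
  qed (use F assms in auto)
  then show ?thesis by blast
qed

text \<open>A nonempty space needs at least one ball, whose term already gives the bound. It is
  uniform in \<open>q\<close>, so it survives the infimum over \<open>q\<close> and makes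
  \<open>fk_sum\<close> positive.\<close>

lemma fk_cover_sums_ge:
  fixes M :: real
  assumes "X \<noteq> {}" "T ` X \<subseteq> X" and M: "\<And>z. z \<in> X \<Longrightarrow> - M \<le> \<phi> z"
    and s: "s \<in> fk_cover_sums X T \<phi> q n \<epsilon>"
  shows "exp (- (n * M)) \<le> s"
proof -
  obtain k :: nat and x where x: "s = (\<Sum>i=1..k. exp (birkhoff_sum T q n \<phi> (x i)))"
    "\<forall>i\<in>{1..k}. x i \<in> X" "(\<Union>i\<in>{1..k}. fk_ball X T q n (x i) \<epsilon>) = X"
    by (rule fk_cover_sumsE[OF s])
  obtain i where i: "i \<in> {1..k}" using x(3) \<open>X \<noteq> {}\<close> by blast
  then have "exp (- (n * M)) \<le> exp (birkhoff_sum T q n \<phi> (x i))"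
    using birkhoff_sum_ge[OF assms(2) _ M, of "x i"] x(2) by simp
  also have "\<dots> \<le> s" unfolding x(1) using i by (intro member_le_sum) auto
  finally show ?thesis .
qed

lemma le_fk_sum:
  assumes "\<And>q. 0 < q \<Longrightarrow> fk_cover_sums X T \<phi> q n \<epsilon> \<noteq> {}"
    and "\<And>q s. 0 < q \<Longrightarrow> s \<in> fk_cover_sums X T \<phi> q n \<epsilon> \<Longrightarrow> c \<le> s"
  shows "c \<le> fk_sum X T \<phi> n \<epsilon>"
  unfolding fk_sum_def fk_cover_sum_eq_Inf
proof (rule cINF_greatest)
  fix q :: nat assume "q \<in> {1..}"
  then have "0 < q" by simp
  then show "c \<le> Inf (fk_cover_sums X T \<phi> q n \<epsilon>)" using assms by (intro cInf_greatest) blast+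
qed simp

text \<open>Use \<open>q = 1\<close>: a spanning set at scale \<open>\<rho>\<close> is the set of
  centres of an FK cover at any larger scale.\<close>

lemma fk_sum_le_spanning_pressure:
  assumes "X \<noteq> {}" and X: "compact X" "T ` X \<subseteq> X"
    and M: "\<And>z. z \<in> X \<Longrightarrow> \<bar>\<phi> z\<bar> \<le> M" and "0 < \<rho>" "\<rho> < \<epsilon>" "0 < n"
  shows "fk_sum X T \<phi> n \<epsilon> \<le> spanning_pressure X T \<phi> n \<rho>" "0 < fk_sum X T \<phi> n \<epsilon>"
proof -
  have M1: "\<phi> z \<le> M" and M2: "- M \<le> \<phi> z" if "z \<in> X" for z
    using M[OF that] by auto
  have ne: "fk_cover_sums X T \<phi> q n \<epsilon> \<noteq> {}" if "0 < q" for q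
    using assms M1 that by (intro fk_cover_sums_nonempty[of X T \<phi> M]) auto
  have ge: "exp (- (n * M)) \<le> s" if "s \<in> fk_cover_sums X T \<phi> q n \<epsilon>" for q s
    using fk_cover_sums_ge[OF assms(1) X(2) M2 that] .
  have "exp (- (n * M)) \<le> fk_sum X T \<phi> n \<epsilon>"
    using ne ge by (intro le_fk_sum) auto
  then show "0 < fk_sum X T \<phi> n \<epsilon>" using exp_gt_zero less_le_trans by blast
  have bdd: "bdd_below (fk_cover_sums X T \<phi> q n \<epsilon>)" for q
    using ge by (intro bdd_belowI)
  obtain C where C: "1 \<le> C" "\<And>a Y. Y \<subseteq> X \<Longrightarrow> orbit_cover T \<phi> \<rho> Y {a} C"
    by (rule orbit_cover_single_time[OF X M1 \<open>0 < \<rho>\<close>]) auto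
  have "orbit_cover T \<phi> \<rho> X {..<n} (C ^ n)"
    using orbit_cover_progression[OF C(2) zero_less_one, where n = n] by simp
  then obtain F\<^sub>0 where F0: "spanning_set X T n \<rho> F\<^sub>0"
    using orbit_cover_spanning_set[OF _ \<open>0 < n\<close>] by blast
  show "fk_sum X T \<phi> n \<epsilon> \<le> spanning_pressure X T \<phi> n \<rho>"
    unfolding spanning_pressure_def
  proof (rule cInf_greatest)
    fix s assume "s \<in> {\<Sum>x\<in>F. exp (birkhoff_sum T 1 n \<phi> x) | F. spanning_set X T n \<rho> F}"
    then obtain F where F: "spanning_set X T n \<rho> F" "s = (\<Sum>x\<in>F. exp (birkhoff_sum T 1 n \<phi> x))"
      by blast
    have "s \<in> fk_cover_sums X T \<phi> 1 n \<epsilon>"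
      unfolding F(2)
    proof (rule fk_cover_sumsI)
      fix x assume "x \<in> X"
      then obtain y where y: "y \<in> F" "bowen_dist T n x y \<le> \<rho>"
        using F(1) by (auto simp: spanning_set_def)
      then show "\<exists>y\<in>F. \<forall>i<n. dist ((T ^^ (1 * i)) x) ((T ^^ (1 * i)) y) \<le> \<rho>"
        using \<open>0 < n\<close> by (auto simp: bowen_dist_le_iff)
    qed (use F(1) assms in \<open>auto simp: spanning_set_def\<close>)
    then have "fk_cover_sum X T \<phi> 1 n \<epsilon> \<le> s"
      unfolding fk_cover_sum_eq_Inf using bdd by (rule cInf_lower)
    moreover have "fk_sum X T \<phi> n \<epsilon> \<le> fk_cover_sum X T \<phi> 1 n \<epsilon>"
      unfolding fk_sum_def
    proof (rule cINF_lower)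
      show "bdd_below ((\<lambda>q. fk_cover_sum X T \<phi> q n \<epsilon>) ` {1..})"
        unfolding fk_cover_sum_eq_Inf using ne ge
        by (intro bdd_belowI2[of _ "exp (- (n * M))"] cInf_greatest) auto
    qed simp
    ultimately show "fk_sum X T \<phi> n \<epsilon> \<le> s" by linarith
  qed (use F0 in blast)
qed

text \<open>Adding the covers of the balls of an FK cover gives one cover of \<open>X\<close>, to
  which the single-cover bound applies. The bound holds for every \<open>q\<close> and every FK
  cover, so the infimum can be taken.\<close>

lemma limsup_spanning_pressure_le_fk_sum:
  assumes "X \<noteq> {}" and X: "compact X" "T ` X \<subseteq> X"
    and M: "\<And>z. z \<in> X \<Longrightarrow> \<bar>\<phi> z\<bar> \<le> M"
    and C: "\<And>a Y. Y \<subseteq> X \<Longrightarrow> orbit_cover T \<phi> \<rho> Y {a} C" "1 \<le> C"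
    and v: "\<And>u w. u \<in> X \<Longrightarrow> w \<in> X \<Longrightarrow> dist u w < \<epsilon> \<Longrightarrow> \<phi> w \<le> \<phi> u + v" "0 \<le> v"
    and \<epsilon>: "0 < \<epsilon>" "\<epsilon> \<le> 1" "\<epsilon> \<le> \<rho> / 2" and n: "0 < n"
  shows "limsup (\<lambda>m. ereal (1 / real m * ln (spanning_pressure X T \<phi> m \<rho>)))
     \<le> ereal (v + ln (match_growth (C * exp M) \<epsilon>) + 1 / n * ln (fk_sum X T \<phi> n \<epsilon>))"
    (is "?L \<le> ereal (v + ln ?G + _)")
proof -
  have M1: "\<phi> z \<le> M" and M2: "- M \<le> \<phi> z" if "z \<in> X" for z
    using M[OF that] by auto
  have "0 < 1 + \<epsilon> * (C * exp M)" using \<epsilon>(1) C(2) by (intro add_pos_nonneg mult_nonneg_nonneg) auto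
  then have G: "0 < ?G" using \<epsilon>(1) by (simp add: match_growth_def)
  have ne: "fk_cover_sums X T \<phi> q n \<epsilon> \<noteq> {}" if "0 < q" for q
    using assms M1 that by (intro fk_cover_sums_nonempty[of X T \<phi> M]) auto
  have pos: "0 < s" if "s \<in> fk_cover_sums X T \<phi> q n \<epsilon>" for q s
    using fk_cover_sums_ge[OF assms(1) X(2) M2 that] exp_gt_zero less_le_trans by blast
  have bound: "?L \<le> ereal (v + ln ?G + 1 / n * ln s)"
    if q: "0 < q" and s: "s \<in> fk_cover_sums X T \<phi> q n \<epsilon>" for q s
  proof -
    obtain k :: nat and x where x: "s = (\<Sum>i=1..k. exp (birkhoff_sum T q n \<phi> (x i)))"
      "\<forall>i\<in>{1..k}. x i \<in> X" "(\<Union>i\<in>{1..k}. fk_ball X T q n (x i) \<epsilon>) = X"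
      by (rule fk_cover_sumsE[OF s])
    have "orbit_cover T \<phi> \<rho> (\<Union>i\<in>{1..k}. fk_ball X T q n (x i) \<epsilon>) ((*) q ` {..<n})
        (\<Sum>i=1..k. (exp v * ?G) ^ n * exp (birkhoff_sum T q n \<phi> (x i)))"
      using x(2) by (intro orbit_cover_UN orbit_cover_fk_ball X C M2 v \<epsilon> q n) auto
    then have "orbit_cover T \<phi> \<rho> X ((*) q ` {..<n}) ((exp v * ?G) ^ n * s)"
      using x(1,3) by (simp add: sum_distrib_left)
    then have "?L \<le> ereal (ln ((exp v * ?G) ^ n * s) / n)"
      using G pos[OF s] by (intro limsup_spanning_pressure_le[of X T M \<phi> \<rho> C q n] assms M2 q) auto
    also have "ln ((exp v * ?G) ^ n * s) / n = v + ln ?G + 1 / n * ln s"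
      using G pos[OF s] n by (simp add: ln_mult ln_realpow field_simps)
    finally show ?thesis .
  qed
  show ?thesis
  \<comment> \<open>For a finite limsup the bound is exponentiated to a lower bound for every cover
    sum, hence for \<open>fk_sum\<close>. A single cover sum rules out an infinite one.\<close>
  proof (cases ?L)
    case (real l)
    have "exp (n * (l - (v + ln ?G))) \<le> fk_sum X T \<phi> n \<epsilon>"
    proof (rule le_fk_sum[OF ne])
      fix q s assume qs: "0 < q" "s \<in> fk_cover_sums X T \<phi> q n \<epsilon>"
      have "l - (v + ln ?G) \<le> 1 / n * ln s" using bound[OF qs] real by simp
      then have "n * (l - (v + ln ?G)) \<le> ln s" using n by (simp add: field_simps)
      then show "exp (n * (l - (v + ln ?G))) \<le> s" using pos[OF qs(2)] by (simp add: ln_ge_iff)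
    qed
    then have "n * (l - (v + ln ?G)) \<le> ln (fk_sum X T \<phi> n \<epsilon>)"
      by (subst ln_ge_iff) (auto intro: less_le_trans[OF exp_gt_zero])
    then have "l \<le> v + ln ?G + 1 / n * ln (fk_sum X T \<phi> n \<epsilon>)" using n by (simp add: field_simps)
    then show ?thesis using real by simp
  next
    case PInf
    obtain s where "s \<in> fk_cover_sums X T \<phi> 1 n \<epsilon>" using ne[of 1] by auto
    then show ?thesis using bound[of 1 s] PInf by simp
  qed simp
qed

section \<open>Passage to the limit\<close>

text \<open>All three functions converge to the supremum of \<open>f\<close> over positive scales.
  Monotonicity of \<open>f\<close> is not assumed: the comparison through \<open>h\<close> replaces
  it. Convergence of \<open>f\<close> identifies \<open>Lim\<close> with that supremum.\<close>

lemma tendsto_Lim_of_interleaved: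
  fixes f g h :: "real \<Rightarrow> ereal"
  assumes gh: "\<And>\<epsilon>. g \<epsilon> \<le> h \<epsilon>" and hf: "\<And>\<rho> \<epsilon>. 0 < \<rho> \<Longrightarrow> \<rho> < \<epsilon> \<Longrightarrow> h \<epsilon> \<le> f \<rho>"
    and fg: "\<And>\<rho> \<eta>. 0 < \<rho> \<Longrightarrow> 0 < \<eta> \<Longrightarrow> \<forall>\<^sub>F \<epsilon> in at_right 0. f \<rho> \<le> g \<epsilon> + ereal \<eta>"
  shows "(g \<longlongrightarrow> Lim (at_right 0) f) (at_right 0) \<and> (h \<longlongrightarrow> Lim (at_right 0) f) (at_right 0)"
proof -
  define S where "S = (SUP \<rho>\<in>{0<..}. f \<rho>)"
  have fS: "f \<rho> \<le> S" if "0 < \<rho>" for \<rho>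
    unfolding S_def using that by (intro SUP_upper) auto
  have hS: "h \<epsilon> \<le> S" if "0 < \<epsilon>" for \<epsilon>
    using hf[of "\<epsilon> / 2" \<epsilon>] fS[of "\<epsilon> / 2"] that by (simp add: order_trans)
  have gS: "g \<epsilon> \<le> S" if "0 < \<epsilon>" for \<epsilon>
    using gh hS[OF that] by (rule order_trans)
  have pos: "\<forall>\<^sub>F \<epsilon> in at_right 0. (0::real) < \<epsilon>" by (rule eventually_at_right_less)
  have low: "\<forall>\<^sub>F \<epsilon> in at_right 0. c < g \<epsilon>" if c: "c < S" for c
  proof -
    obtain \<rho> where \<rho>: "0 < \<rho>" "c < f \<rho>" using c unfolding S_def less_SUP_iff by auto
    \<comment> \<open>Two reals between \<open>c\<close> and \<open>f \<rho>\<close> give a real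
      slack \<open>r' - r\<close>, even if these values are infinite.\<close>
    obtain r where r: "c < ereal r" "ereal r < f \<rho>" using ereal_dense2[OF \<rho>(2)] by blast
    obtain r' where r': "ereal r < ereal r'" "ereal r' < f \<rho>" using ereal_dense2[OF r(2)] by blast
    have "\<forall>\<^sub>F \<epsilon> in at_right 0. f \<rho> \<le> g \<epsilon> + ereal (r' - r)"
      using \<rho>(1) r'(1) by (intro fg) auto
    then show ?thesis
    proof (rule eventually_mono)
      fix \<epsilon> assume "f \<rho> \<le> g \<epsilon> + ereal (r' - r)"
      then have "ereal r' < g \<epsilon> + ereal (r' - r)" using r'(2) by (rule less_le_trans[rotated])
      then have "ereal r < g \<epsilon>" by (cases "g \<epsilon>") auto
      then show "c < g \<epsilon>" using r(1) by (rule less_trans[rotated])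
    qed
  qed
  have g: "(g \<longlongrightarrow> S) (at_right 0)"
  proof (rule order_tendstoI)
    fix c assume "S < c"
    then show "\<forall>\<^sub>F \<epsilon> in at_right 0. g \<epsilon> < c"
      using gS by (intro eventually_mono[OF pos]) (meson le_less_trans)
  qed (rule low)
  have h: "(h \<longlongrightarrow> S) (at_right 0)"
  proof (rule order_tendstoI)
    fix c assume "S < c"
    then show "\<forall>\<^sub>F \<epsilon> in at_right 0. h \<epsilon> < c"
      using hS by (intro eventually_mono[OF pos]) (meson le_less_trans)
  next
    fix c assume "c < S"
    then show "\<forall>\<^sub>F \<epsilon> in at_right 0. c < h \<epsilon>"
      using gh by (intro eventually_mono[OF low]) (auto intro: less_le_trans)
  qed
  have "(f \<longlongrightarrow> S) (at_right 0)"
  proof (rule order_tendstoI)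
    fix c assume "S < c"
    then show "\<forall>\<^sub>F \<epsilon> in at_right 0. f \<epsilon> < c"
      using fS by (intro eventually_mono[OF pos]) (meson le_less_trans)
  next
    fix c assume "c < S"
    then obtain b where b: "0 < b" "\<And>\<epsilon>. 0 < \<epsilon> \<Longrightarrow> \<epsilon> < b \<Longrightarrow> c < g \<epsilon>"
      using low unfolding eventually_at_right_field by blast
    have "c < f \<rho>" if "0 < \<rho>" "\<rho> < b" for \<rho>
    proof -
      \<comment> \<open>The midpoint is larger than \<open>\<rho>\<close>, as \<open>hf\<close>
        demands, but still below \<open>b\<close>.\<close>
      have "c < g ((\<rho> + b) / 2)" using that by (intro b(2)) auto
      also have "\<dots> \<le> h ((\<rho> + b) / 2)" by (rule gh)
      also have "\<dots> \<le> f \<rho>" using that by (intro hf) auto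
      finally show ?thesis .
    qed
    then show "\<forall>\<^sub>F \<epsilon> in at_right 0. c < f \<epsilon>"
      using b(1) unfolding eventually_at_right_field by blast
  qed
  then have "Lim (at_right 0) f = S" by (intro tendsto_Lim) auto
  then show ?thesis using g h by simp
qed

lemma pressure_empty:
  "spanning_pressure {} T \<phi> n \<epsilon> = 0" "fk_sum {} T \<phi> n \<epsilon> = 0"
proof -
  have "{\<Sum>x\<in>F. exp (birkhoff_sum T 1 n \<phi> x) | F. spanning_set {} T n \<epsilon> F} = {0}"
    by (auto simp: spanning_set_def)
  then show "spanning_pressure {} T \<phi> n \<epsilon> = 0" by (simp add: spanning_pressure_def)
  have "fk_cover_sums {} T \<phi> q n \<epsilon> = {0}" for q
  proof (intro equalityI subsetI)
    fix s assume "s \<in> fk_cover_sums {} T \<phi> q n \<epsilon>"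
    then show "s \<in> {0}" by (auto simp: fk_cover_sums_def Ball_def)
  next
    fix s :: real assume "s \<in> {0}"
    then show "s \<in> fk_cover_sums {} T \<phi> q n \<epsilon>"
      unfolding fk_cover_sums_def mem_Collect_eq by (intro exI[of _ 0]) auto
  qed
  then show "fk_sum {} T \<phi> n \<epsilon> = 0"
    by (simp add: fk_sum_def fk_cover_sum_eq_Inf)
qed

theorem theorem4p3:
  fixes X :: "'a::metric_space set" and T T' :: "'a \<Rightarrow> 'a" and \<phi> :: "'a \<Rightarrow> real"
  assumes "compact X"
    and "homeomorphism X X T T'"
    and "continuous_on X \<phi>"
  shows "((\<lambda>\<epsilon>. liminf (\<lambda>n. ereal (1 / real n * ln (fk_sum X T \<phi> n \<epsilon>))))
            \<longlongrightarrow> top_pressure X T \<phi>) (at_right 0) \<and>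
         ((\<lambda>\<epsilon>. limsup (\<lambda>n. ereal (1 / real n * ln (fk_sum X T \<phi> n \<epsilon>))))
            \<longlongrightarrow> top_pressure X T \<phi>) (at_right 0)"
proof (cases "X = {}")
  case True
  \<comment> \<open>On the empty space both sums are 0, and \<open>ln 0 = 0\<close> makes every term
    of the sequences 0.\<close>
  have "Lim (at_right 0) (\<lambda>\<epsilon>::real. 0 :: ereal) = 0"
    by (intro tendsto_Lim) auto
  then show ?thesis
    unfolding True top_pressure_def pressure_empty
    by (simp add: Limsup_const Liminf_const zero_ereal_def[symmetric])
next
  case False
  have TX: "T ` X \<subseteq> X" using assms(2) by (simp add: homeomorphism_def)
  have "compact (\<phi> ` X)" using assms(1,3) by (rule compact_continuous_image[rotated])
  then obtain M where M: "\<And>z. z \<in> X \<Longrightarrow> \<bar>\<phi> z\<bar> \<le> M"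
    using compact_imp_bounded bounded_real by (metis imageI)
  have unif: "uniformly_continuous_on X \<phi>"
    using assms(3,1) by (rule compact_uniformly_continuous)
  show ?thesis
    unfolding top_pressure_def
  proof (rule tendsto_Lim_of_interleaved)
    fix \<rho> \<epsilon> :: real assume \<rho>: "0 < \<rho>" "\<rho> < \<epsilon>"
    show "limsup (\<lambda>n. ereal (1 / real n * ln (fk_sum X T \<phi> n \<epsilon>)))
        \<le> limsup (\<lambda>n. ereal (1 / real n * ln (spanning_pressure X T \<phi> n \<rho>)))"
    proof (rule Limsup_mono, rule eventually_mono[OF eventually_gt_at_top[of 0]])
      fix n :: nat assume n: "0 < n"
      have "ln (fk_sum X T \<phi> n \<epsilon>) \<le> ln (spanning_pressure X T \<phi> n \<rho>)"
        using fk_sum_le_spanning_pressure[OF False assms(1) TX M \<rho> n] by (intro ln_mono) auto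
      then show "ereal (1 / real n * ln (fk_sum X T \<phi> n \<epsilon>))
          \<le> ereal (1 / real n * ln (spanning_pressure X T \<phi> n \<rho>))"
        by (simp add: divide_right_mono)
    qed
  next
    fix \<rho> \<eta> :: real assume \<rho>: "0 < \<rho>" and \<eta>: "0 < \<eta>"
    obtain C where C: "1 \<le> C" "\<And>a Y. Y \<subseteq> X \<Longrightarrow> orbit_cover T \<phi> \<rho> Y {a} C"
      by (rule orbit_cover_single_time[OF assms(1) TX _ \<rho>, of \<phi> M]) (use M in \<open>auto simp: abs_le_iff\<close>)
    obtain d where d: "0 < d" "\<And>u w. u \<in> X \<Longrightarrow> w \<in> X \<Longrightarrow> dist w u < d \<Longrightarrow> dist (\<phi> w) (\<phi> u) < \<eta> / 2"
      using uniformly_continuous_onE[OF unif, of "\<eta> / 2"] \<eta> by (metis half_gt_zero)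
    \<comment> \<open>\<open>C\<close> depends on \<open>\<rho>\<close> but not on
      \<open>\<epsilon>\<close>, so the growth term tends to 0. It uses one half of
      \<open>\<eta>\<close>, the oscillation of the potential the other.\<close>
    have "((\<lambda>\<epsilon>. ln (match_growth (C * exp M) \<epsilon>)) \<longlongrightarrow> ln 1) (at_right 0)"
      by (intro tendsto_ln match_growth_tendsto) simp
    then have "\<forall>\<^sub>F \<epsilon> in at_right 0. ln (match_growth (C * exp M) \<epsilon>) < \<eta> / 2"
      using \<eta> by (intro order_tendstoD(2)) auto
    \<comment> \<open>The three bounds serve the counting of matches, the uniform continuity of the
      potential and the diameter of the pieces.\<close>
    moreover have "\<forall>\<^sub>F \<epsilon> in at_right 0. \<epsilon> \<in> {0 <..< Min {1, d, \<rho> / 2}}"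
      using \<rho> d(1) by (intro eventually_at_right_real) auto
    ultimately show "\<forall>\<^sub>F \<epsilon> in at_right 0.
        limsup (\<lambda>m. ereal (1 / real m * ln (spanning_pressure X T \<phi> m \<rho>)))
        \<le> liminf (\<lambda>n. ereal (1 / real n * ln (fk_sum X T \<phi> n \<epsilon>))) + ereal \<eta>"
    proof eventually_elim
      case (elim \<epsilon>)
      let ?L = "limsup (\<lambda>m. ereal (1 / real m * ln (spanning_pressure X T \<phi> m \<rho>)))"
      \<comment> \<open>The bound holds for each single \<open>n > 0\<close> with the same left-hand
        side, which is why even the liminf is bounded below.\<close>
      have "?L - ereal \<eta> \<le> liminf (\<lambda>n. ereal (1 / real n * ln (fk_sum X T \<phi> n \<epsilon>)))"
      proof (rule Liminf_bounded, rule eventually_mono[OF eventually_gt_at_top[of 0]])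
        fix n :: nat assume n: "0 < n"
        have "?L \<le> ereal (\<eta> / 2 + ln (match_growth (C * exp M) \<epsilon>)
            + 1 / n * ln (fk_sum X T \<phi> n \<epsilon>))"
        proof (rule limsup_spanning_pressure_le_fk_sum[OF False assms(1) TX M C(2,1)])
          fix u w assume "u \<in> X" "w \<in> X" "dist u w < \<epsilon>"
          then have "dist (\<phi> w) (\<phi> u) < \<eta> / 2" using elim(2) by (intro d(2)) (auto simp: dist_commute)
          then show "\<phi> w \<le> \<phi> u + \<eta> / 2" unfolding dist_real_def by linarith
        qed (use elim n \<eta> in auto)
        also have "\<dots> \<le> ereal (\<eta> + 1 / n * ln (fk_sum X T \<phi> n \<epsilon>))"
          using elim(1) by simp
        finally show "?L - ereal \<eta> \<le> ereal (1 / real n * ln (fk_sum X T \<phi> n \<epsilon>))"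
          by (cases ?L) auto
      qed
      then show ?case by (simp add: ereal_minus_le_iff)
    qed
  qed (simp add: Liminf_le_Limsup)
qed

end
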